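(* For every $F\in\mathcal P_A(P_{\rm avg})$, the holomorphic influence function $\Psi_F$ satisfies $$\Psi_F(x)\ge x\log x-O(x),\qquad x\to+\infty\ \text{ along the real axis}.$$ Consequently, for every finite $\lambda\ge0$, $\Psi_F(x)-\lambda x\to+\infty$ as $x\to+\infty$.
   Context: Setting: $L\ge0$ an integer, $\lambda_0>0$, $h_0>0$, $h_\ell\ge0$, $\sum_{\ell=0}^L h_\ell=1$, $0\le A<\infty$, $P_{\rm avg}\ge0$; $\mathcal P_A(P_{\rm avg})$ is the set of Borel probability measures on $[0,A]$ with mean at most $P_{\rm avg}$. $P_F,\mathbb E_F,H_F,I_F$ refer to the stationary process with $(X_k)_{k\in\mathbb Z}$ i.i.d. of law $F$ and, given the inputs, conditionally independent $Y_k\sim\operatorname{Poisson}(Z_k)$, $Z_k=\lambda_0+\sum_{\ell=0}^L h_\ell X_{k-\ell}$. Logarithms are natural (principal branch for complex arguments); $Y_i^j=(Y_i,\dots,Y_j)$. Let $h_+=\max_{r:\,h_r>0}h_r$ and $\Omega=\{z\in\mathbb C:\operatorname{Re}z>-\lambda_0/h_+\}$. Definition of $\Psi_F$ on $\Omega$: $\Psi_F(z)=\dot h_{Y,F}^{\rm hol}(z)-\dot h_{Y|X,F}^{\rm hol}(z)$, a holomorphic function on $\Omega$ which on $[0,A]$ equals the point-mass influence $\left.\frac{d}{d\epsilon}\mathcal I((1-\epsilon)F+\epsilon\delta_x)\right|_{\epsilon=0^+}$ of the stationary mutual information rate $\mathcal I(F)=\lim_n\frac1n I_F(X_1^n;Y_1^n)$.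 The two parts are as follows. (i) $\dot h_{Y,F}^{\rm hol}(z)=\sum_{t=0}^\infty\Delta_t(z)$ with $\Delta_t=\lim_{m\to\infty}\Delta_{t,m}$ (locally uniform limit and locally uniformly absolutely convergent series on $\Omega$), where $$\Delta_{t,m}(z)=\sum_{y_{t-m}^t}\bigl(-\log P_F(Y_t=y_t\mid Y_{t-m}^{t-1}=y_{t-m}^{t-1})\bigr)\bigl[\Lambda_{t,m}^{(z)}-\Lambda_{t,m}^{(F)}\bigr](y_{t-m}^t);$$ $\Lambda_{t,m}^{(F)}$ is the baseline law of $Y_{t-m}^t$, and $\Lambda_{t,m}^{(z)}$ is the finite complex measure obtained by setting $X_0=z$ in the Poisson means, i.e. replacing each affected Poisson kernel by $e^{-\zeta}\zeta^{y}/y!$ with complex mean $\zeta$, with all other inputs i.i.d. of law $F$ and integrated out. (ii) $$\dot h_{Y|X,F}^{\rm hol}(z)=\sum_{r=0}^L\mathbb E_F\Bigl[\phi\bigl(\lambda_0+h_rz+\textstyle\sum_{\ell\ne r}h_\ell X_{-\ell}\bigr)-\phi\bigl(\lambda_0+\sum_{\ell=0}^L h_\ell X_{-\ell}\bigr)\Bigr],$$ where $\phi(\zeta)=\zeta-\zeta\log\zeta+\sum_{m\ge0}e^{-\zeta}\frac{\zeta^m}{m!}\log(m!)$ for $\operatorname{Re}\zeta>0$ (the Poisson entropy function). For $x>A$, $\Psi_F(x)$ is the (real) value of this analytic extension. *)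

theory Defs
  imports "HOL-Probability.Probability" "HOL-Complex_Analysis.Complex_Analysis"
    "HOL-Library.Landau_Symbols"
begin

text \<open>
  \<open>\<P>\<^sub>A(P)\<close>. The base space is the interval itself, so an input configuration sampled from
  \<open>PiM UNIV (\<lambda>_. F)\<close> takes all of its values in \<open>[0, A]\<close>, not merely almost all.
\<close>

definition input_laws :: "real \<Rightarrow> real \<Rightarrow> real measure set" where
  "input_laws A P_avg =
     {F \<in> space (prob_algebra (restrict_space borel {0..A})). (\<integral>x. x \<partial>F) \<le> P_avg}"

definition iid_inputs :: "real measure \<Rightarrow> (int \<Rightarrow> real) measure" where
  "iid_inputs F = (\<Pi>\<^sub>M i\<in>UNIV. F)"

definition poisson_kernel :: "complex \<Rightarrow> nat \<Rightarrow> complex" where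
  "poisson_kernel \<zeta> n = exp (- \<zeta>) * \<zeta> ^ n / fact n"

text \<open>The Poisson entropy function; \<^term>\<open>ln\<close> on \<^typ>\<open>complex\<close> is the principal branch.\<close>

definition poisson_entropy :: "complex \<Rightarrow> complex" where
  "poisson_entropy \<zeta> =
     \<zeta> - \<zeta> * ln \<zeta> + (\<Sum>m. poisson_kernel \<zeta> m * of_real (ln (fact m)))"

definition window :: "nat \<Rightarrow> nat \<Rightarrow> int set" where
  "window t m = {int t - int m..int t}"

context
  fixes L :: nat and lam0 :: real and h :: "nat \<Rightarrow> real"
begin

text \<open>The mean \<open>Z\<^sub>k\<close>; used for real inputs and, with one complex input, for the extension.\<close>

definition channel_mean :: "(int \<Rightarrow> 'a::real_normed_field) \<Rightarrow> int \<Rightarrow> 'a" where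
  "channel_mean x k = of_real lam0 + (\<Sum>l\<le>L. of_real (h l) * x (k - int l))"

text \<open>The law of \<open>(Y\<^sub>k)\<close>, \<open>k \<in> \<int>\<close>, in the stationary process with inputs i.i.d. of law \<open>F\<close>.\<close>

definition output_law :: "real measure \<Rightarrow> (int \<Rightarrow> nat) measure" where
  "output_law F =
     iid_inputs F \<bind> (\<lambda>X. \<Pi>\<^sub>M k\<in>UNIV. measure_pmf (poisson_pmf (channel_mean X k)))"

definition cond_output_prob :: "real measure \<Rightarrow> nat \<Rightarrow> nat \<Rightarrow> (int \<Rightarrow> nat) \<Rightarrow> real" where
  "cond_output_prob F t m y =
     \<P>(Y in output_law F. Y (int t) = y (int t) \<bar> (\<forall>k \<in> {int t - int m..<int t}. Y k = y k))"

definition baseline_law :: "real measure \<Rightarrow> nat \<Rightarrow> nat \<Rightarrow> (int \<Rightarrow> nat) \<Rightarrow> real" where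
  "baseline_law F t m y = \<P>(Y in output_law F. \<forall>k \<in> window t m. Y k = y k)"

definition perturbed_law ::
    "real measure \<Rightarrow> nat \<Rightarrow> nat \<Rightarrow> complex \<Rightarrow> (int \<Rightarrow> nat) \<Rightarrow> complex" where
  "perturbed_law F t m z y =
     (\<integral>X. (\<Prod>k\<in>window t m.
        poisson_kernel (channel_mean ((\<lambda>i. complex_of_real (X i))(0 := z)) k) (y k)) \<partial>iid_inputs F)"

definition Delta_trunc :: "real measure \<Rightarrow> nat \<Rightarrow> nat \<Rightarrow> complex \<Rightarrow> complex" where
  "Delta_trunc F t m z =
     (\<Sum>\<^sub>\<infinity>y \<in> window t m \<rightarrow>\<^sub>E UNIV.
        of_real (- ln (cond_output_prob F t m y)) *
        (perturbed_law F t m z y - of_real (baseline_law F t m y)))"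

definition Delta :: "real measure \<Rightarrow> nat \<Rightarrow> complex \<Rightarrow> complex" where
  "Delta F t z = lim (\<lambda>m. Delta_trunc F t m z)"

definition hdot_Y :: "real measure \<Rightarrow> complex \<Rightarrow> complex" where
  "hdot_Y F z = (\<Sum>t. Delta F t z)"

definition hdot_YX :: "real measure \<Rightarrow> complex \<Rightarrow> complex" where
  "hdot_YX F z =
     (\<Sum>r\<le>L. \<integral>X.
        (poisson_entropy (of_real lam0 + of_real (h r) * z
            + (\<Sum>l\<in>{..L} - {r}. of_real (h l * X (- int l))))
         - poisson_entropy (of_real (lam0 + (\<Sum>l\<le>L. h l * X (- int l))))) \<partial>iid_inputs F)"

text \<open>
  The holomorphic influence function. It is only meaningful for \<open>Re z > - lam0 / h\<^sub>+\<close>, where the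
  limits defining \<^term>\<open>hdot_Y\<close> exist locally uniformly; this half-plane contains \<open>[0, \<infinity>)\<close>.
\<close>

definition Psi :: "real measure \<Rightarrow> complex \<Rightarrow> complex" where
  "Psi F z = hdot_Y F z - hdot_YX F z"

lemma output_kernel_measurable:
  assumes lam0: "lam0 > 0" and h: "\<forall>l\<le>L. h l \<ge> 0"
    and F: "F \<in> space (prob_algebra (restrict_space borel {0..A}))"
  shows "(\<lambda>X. \<Pi>\<^sub>M k\<in>UNIV. measure_pmf (poisson_pmf (channel_mean X k)))
           \<in> iid_inputs F \<rightarrow>\<^sub>M prob_algebra (\<Pi>\<^sub>M k\<in>UNIV. count_space UNIV)"
    and "\<And>X k. X \<in> space (iid_inputs F) \<Longrightarrow> channel_mean X k > 0"
    and "\<And>k. (\<lambda>X. channel_mean X k) \<in> borel_measurable (iid_inputs F)"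
proof -
  have sF: "sets F = sets (restrict_space borel {0..A})"
    using F by (simp add: space_prob_algebra)
  have spF: "space F = {0..A}"
    using sets_eq_imp_space_eq[OF sF] by (simp add: space_restrict_space)
  have sub: "(\<lambda>x. x) \<in> borel_measurable F"
    unfolding measurable_cong_sets[OF sF refl] by (rule measurable_restrict_space1) simp
  have comp: "(\<lambda>X. X i) \<in> borel_measurable (iid_inputs F)" for i
    unfolding iid_inputs_def
    using measurable_compose[OF measurable_component_singleton[of i UNIV "\<lambda>_. F"] sub] by simp
  show meas [measurable]: "(\<lambda>X. channel_mean X k) \<in> borel_measurable (iid_inputs F)" for k
    unfolding channel_mean_def using comp by measurable
  show pos: "channel_mean X k > 0" if "X \<in> space (iid_inputs F)" for X :: "int \<Rightarrow> real" and k
  proof -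
    have "X i \<ge> 0" for i
      using that by (auto simp: iid_inputs_def space_PiM spF PiE_iff)
    then have "(\<Sum>l\<le>L. h l * X (k - int l)) \<ge> 0"
      using h by (intro sum_nonneg mult_nonneg_nonneg) auto
    then show ?thesis using lam0 by (simp add: channel_mean_def)
  qed
  let ?K = "\<lambda>X. \<Pi>\<^sub>M k\<in>UNIV. measure_pmf (poisson_pmf (channel_mean X k))"
  have setsK: "sets (?K X) = sets (\<Pi>\<^sub>M k\<in>UNIV. count_space UNIV)" for X :: "int \<Rightarrow> real"
    by (intro sets_PiM_cong) auto
  show "?K \<in> iid_inputs F \<rightarrow>\<^sub>M prob_algebra (\<Pi>\<^sub>M k\<in>UNIV. count_space UNIV)"
  proof (rule measurable_prob_algebra_generated[OF sets_PiM Int_stable_prod_algebra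
        prod_algebra_sets_into_space])
    fix X :: "int \<Rightarrow> real"
    show "prob_space (?K X)" by (intro prob_space_PiM) (rule prob_space_measure_pmf)
    show "sets (?K X) = sets (\<Pi>\<^sub>M k\<in>UNIV. count_space UNIV)" by (rule setsK)
  next
    fix E :: "(int \<Rightarrow> nat) set"
    assume "E \<in> prod_algebra UNIV (\<lambda>k. count_space UNIV)"
    then obtain J B where E: "E = prod_emb UNIV (\<lambda>k. count_space UNIV) J (\<Pi>\<^sub>E j\<in>J. B j)"
      and J: "finite J" by (rule prod_algebraE) blast
    have eq: "emeasure (?K X) E =
        (\<Prod>j\<in>J. \<integral>\<^sup>+n. ennreal (exp (- channel_mean X j) * channel_mean X j ^ n / fact n)
           * indicator (B j) n \<partial>count_space UNIV)"
      if "X \<in> space (iid_inputs F)" for X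
    proof -
      interpret product_prob_space "\<lambda>k. measure_pmf (poisson_pmf (channel_mean X k))" UNIV
        by standard
      have "emeasure (?K X) E = (\<Prod>j\<in>J. emeasure (measure_pmf (poisson_pmf (channel_mean X j))) (B j))"
        using emeasure_PiM_emb[of J B] J by (simp add: E prod_emb_def)
      also have "\<dots> = (\<Prod>j\<in>J. \<integral>\<^sup>+n. ennreal (pmf (poisson_pmf (channel_mean X j)) n)
           * indicator (B j) n \<partial>count_space UNIV)"
        by (simp add: nn_integral_measure_pmf[symmetric])
      also have "\<dots> = (\<Prod>j\<in>J. \<integral>\<^sup>+n. ennreal (exp (- channel_mean X j) * channel_mean X j ^ n / fact n)
           * indicator (B j) n \<partial>count_space UNIV)"
        using pos[OF that] by (simp add: mult_ac)
      finally show ?thesis .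
    qed
    show "(\<lambda>X. emeasure (?K X) E) \<in> borel_measurable (iid_inputs F)"
      by (simp add: measurable_cong[OF eq] nn_integral_count_space_nat)
  qed
qed

text \<open>The finite-dimensional output laws are the Poisson mixtures they are meant to be.\<close>

lemma output_law_cylinder:
  assumes lam0: "lam0 > 0" and h: "\<forall>l\<le>L. h l \<ge> 0"
    and F: "F \<in> space (prob_algebra (restrict_space borel {0..A}))" and J: "finite J"
  shows "\<P>(Y in output_law F. \<forall>k\<in>J. Y k = y k) =
    (\<integral>X. (\<Prod>k\<in>J. exp (- channel_mean X k) * channel_mean X k ^ y k / fact (y k)) \<partial>iid_inputs F)"
    and "prob_space (output_law F)"
    and "sets (output_law F) = sets (\<Pi>\<^sub>M k\<in>UNIV. count_space UNIV)"
proof -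
  let ?N = "\<Pi>\<^sub>M k\<in>(UNIV :: int set). count_space (UNIV :: nat set)"
  let ?K = "\<lambda>X. \<Pi>\<^sub>M k\<in>UNIV. measure_pmf (poisson_pmf (channel_mean X k))"
  note K = output_kernel_measurable[OF lam0 h F]
  have Fp: "prob_space F" using F by (simp add: space_prob_algebra)
  interpret X: prob_space "iid_inputs F"
    unfolding iid_inputs_def using Fp by (intro prob_space_PiM)
  have I: "iid_inputs F \<in> space (prob_algebra (iid_inputs F))"
    using X.prob_space_axioms by (simp add: space_prob_algebra)
  have Ks: "?K \<in> iid_inputs F \<rightarrow>\<^sub>M subprob_algebra ?N"
    using K(1) by (rule measurable_prob_algebraD)
  have "output_law F \<in> space (prob_algebra ?N)"
    unfolding output_law_def
    using prob_space_bind'[OF I K(1)] sets_bind'[OF I K(1)] by (simp add: space_prob_algebra)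
  then show "prob_space (output_law F)" and S: "sets (output_law F) = sets ?N"
    by (auto simp: space_prob_algebra)
  let ?E = "{Y. \<forall>k\<in>J. Y k = y k}"
  have Eemb: "?E = prod_emb UNIV (\<lambda>k. count_space UNIV) J (\<Pi>\<^sub>E j\<in>J. {y j})"
    by (auto simp: prod_emb_def PiE_iff)
  have Em: "?E \<in> sets ?N" unfolding Eemb using J by (intro sets_PiM_I) auto
  have "\<P>(Y in output_law F. \<forall>k\<in>J. Y k = y k) = measure (output_law F) ?E"
    using sets_eq_imp_space_eq[OF S] by (simp add: space_PiM)
  also have "\<dots> = (\<integral>X. measure (?K X) ?E \<partial>iid_inputs F)"
    unfolding output_law_def by (rule X.measure_bind[OF Ks Em])
  also have "\<dots> = (\<integral>X. (\<Prod>k\<in>J. exp (- channel_mean X k) * channel_mean X k ^ y k / fact (y k)) \<partial>iid_inputs F)"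
  proof (rule Bochner_Integration.integral_cong[OF refl])
    fix X assume X: "X \<in> space (iid_inputs F)"
    interpret product_prob_space "\<lambda>k. measure_pmf (poisson_pmf (channel_mean X k))" UNIV
      by standard
    have "emeasure (?K X) ?E = (\<Prod>j\<in>J. emeasure (measure_pmf (poisson_pmf (channel_mean X j))) {y j})"
      using emeasure_PiM_emb[of J "\<lambda>j. {y j}"] J by (simp add: Eemb prod_emb_def)
    also have "\<dots> = ennreal (\<Prod>j\<in>J. pmf (poisson_pmf (channel_mean X j)) (y j))"
      by (simp add: emeasure_pmf_single prod_ennreal)
    finally have "measure (?K X) ?E = (\<Prod>j\<in>J. pmf (poisson_pmf (channel_mean X j)) (y j))"
      by (simp add: measure_def prod_nonneg)
    then show "measure (?K X) ?E = (\<Prod>k\<in>J. exp (- channel_mean X k) * channel_mean X k ^ y k / fact (y k))"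
      using K(2)[OF X] by (simp add: mult_ac)
  qed
  finally show "\<P>(Y in output_law F. \<forall>k\<in>J. Y k = y k) =
    (\<integral>X. (\<Prod>k\<in>J. exp (- channel_mean X k) * channel_mean X k ^ y k / fact (y k)) \<partial>iid_inputs F)" .
qed

end

end

theory Submission
  imports Defs
begin

text \<open>
  For real \<open>x \<ge> 0\<close> every quantity is real and the perturbed law is the output law with \<open>X\<^sub>0 = x\<close>.
  The growth comes from the times \<open>t \<le> L\<close>, at which the mean of \<open>Y\<^sub>t\<close> is at least \<open>h\<^sub>t x\<close>: the conditional
  probability of \<open>Y\<^sub>t = n\<close> is at most \<open>(\<lambda>\<^sub>0 + A)\<^sup>n / n!\<close>, and \<open>ln n! \<ge> n ln x - x\<close> gives
  \<open>\<Delta>\<^sub>t(x) \<ge> h\<^sub>t x ln x - O(x)\<close>; these add up to \<open>x ln x - O(x)\<close> since \<open>\<Sum> h\<^sub>t = 1\<close>. The times \<open>t > L\<close>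
  contribute \<open>O(1)\<close>, uniformly in \<open>x\<close>, because the filter forgets: the extreme values of the conditional
  probability of \<open>y\<^sub>t\<close> over all pasts before a block of \<open>L + 1\<close> outputs get closer by a factor \<open>1 - \<epsilon>\<close>,
  where \<open>\<epsilon>\<close> is a product of functions of the single outputs, so the expected contraction is geometric.
  The same estimate gives the convergence of the limits in \<open>m\<close>. Finally the Poisson entropy is at
  most \<open>\<zeta> + 1\<close>, so the conditional entropy part is \<open>O(x)\<close>.
\<close>

section \<open>Functions of some of the coordinates only\<close>

definition depends_on :: "'k set \<Rightarrow> (('k \<Rightarrow> 'v) \<Rightarrow> 'b) \<Rightarrow> bool" where
  "depends_on S f \<longleftrightarrow> (\<forall>x y. (\<forall>k\<in>S. x k = y k) \<longrightarrow> f x = f y)"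

lemma depends_onI:
  assumes "\<And>x y. (\<And>k. k \<in> S \<Longrightarrow> x k = y k) \<Longrightarrow> f x = f y"
  shows "depends_on S f"
  unfolding depends_on_def using assms by blast

lemma depends_onD:
  assumes "depends_on S f" "\<And>k. k \<in> S \<Longrightarrow> x k = y k"
  shows "f x = f y"
  using assms unfolding depends_on_def by blast

lemma depends_on_mono:
  assumes "depends_on S f" "S \<subseteq> T"
  shows "depends_on T f"
  using assms unfolding depends_on_def by blast

lemma depends_on_compose2:
  assumes "depends_on S f" "depends_on S g"
  shows "depends_on S (\<lambda>x. F (f x) (g x))"
proof (rule depends_onI)
  fix x y :: "'a \<Rightarrow> 'b" assume "\<And>k. k \<in> S \<Longrightarrow> x k = y k"
  then have "f x = f y" "g x = g y"
    using assms by (auto intro: depends_onD)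
  then show "F (f x) (g x) = F (f y) (g y)" by simp
qed

lemma depends_on_prod:
  assumes "\<And>j. j \<in> J \<Longrightarrow> depends_on S (f j)"
  shows "depends_on S (\<lambda>x. \<Prod>j\<in>J. f j x)"
  by (intro depends_onI prod.cong refl) (rule depends_onD[OF assms])

section \<open>Products and mixtures of Poisson laws\<close>

lemma nn_integral_Pi_pmf_subset:
  assumes "finite W" "A \<subseteq> W" "depends_on A f"
  shows "nn_integral (Pi_pmf A d p) f = nn_integral (Pi_pmf W d p) f"
  unfolding Pi_pmf_subset[OF assms(1,2)] nn_integral_map_pmf
  by (intro nn_integral_cong depends_onD[OF assms(3)]) auto

text \<open>The coordinates in \<open>A\<close> and in \<open>W - A\<close> are independent under a
  product law, and \<open>g\<close> sees only the latter. With extended nonnegative values no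
  integrability has to be checked.\<close>

lemma nn_integral_Pi_pmf_mult:
  assumes W: "finite W" and A: "A \<subseteq> W" and B: "B \<subseteq> W" and AB: "A \<inter> B = {}"
    and f: "depends_on A f" and g: "depends_on B g"
  shows "(\<integral>\<^sup>+y. f y * g y \<partial>Pi_pmf W d p) = nn_integral (Pi_pmf W d p) f * nn_integral (Pi_pmf W d p) g"
proof -
  have g': "depends_on (W - A) g" using g by (rule depends_on_mono) (use B AB in auto)
  have "(\<integral>\<^sup>+y. f y * g y \<partial>Pi_pmf W d p) = (\<integral>\<^sup>+y. f y * g y \<partial>Pi_pmf (A \<union> (W - A)) d p)"
    using A by (simp add: Un_absorb1)
  also have "\<dots> = (\<integral>\<^sup>+a. \<integral>\<^sup>+b. f (\<lambda>x. if x \<in> A then a x else b x) * g (\<lambda>x. if x \<in> A then a x else b x)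
      \<partial>Pi_pmf (W - A) d p \<partial>Pi_pmf A d p)"
    using W A by (subst Pi_pmf_union) (auto simp: finite_subset nn_integral_pair_pmf')
  also have "\<dots> = (\<integral>\<^sup>+a. \<integral>\<^sup>+b. f a * g b \<partial>Pi_pmf (W - A) d p \<partial>Pi_pmf A d p)"
    by (intro nn_integral_cong arg_cong2[of _ _ _ _ "(*)"] depends_onD[OF f] depends_onD[OF g']) auto
  also have "\<dots> = nn_integral (Pi_pmf A d p) f * nn_integral (Pi_pmf (W - A) d p) g"
    by (simp add: nn_integral_cmult nn_integral_multc)
  finally show ?thesis
    using nn_integral_Pi_pmf_subset[OF W A f, of d p] nn_integral_Pi_pmf_subset[OF W _ g', of d p]
    by simp
qed

text \<open>One factor is split off at a time: the remaining product depends on the union of the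
  other sets, which is disjoint from \<open>S i\<close>.\<close>

lemma nn_integral_Pi_pmf_disjoint_prod:
  assumes W: "finite W" and J: "finite J"
    and "\<And>j. j \<in> J \<Longrightarrow> S j \<subseteq> W" "disjoint_family_on S J" "\<And>j. j \<in> J \<Longrightarrow> depends_on (S j) (f j)"
  shows "(\<integral>\<^sup>+y. (\<Prod>j\<in>J. f j y) \<partial>Pi_pmf W d p) = (\<Prod>j\<in>J. nn_integral (Pi_pmf W d p) (f j))"
  using J assms(3-5)
proof (induction rule: finite_induct)
  case (insert i J)
  have "(\<integral>\<^sup>+y. (\<Prod>j\<in>insert i J. f j y) \<partial>Pi_pmf W d p) = (\<integral>\<^sup>+y. f i y * (\<Prod>j\<in>J. f j y) \<partial>Pi_pmf W d p)"
    using insert.hyps by simp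
  also have "\<dots> = nn_integral (Pi_pmf W d p) (f i) * (\<integral>\<^sup>+y. (\<Prod>j\<in>J. f j y) \<partial>Pi_pmf W d p)"
  proof (rule nn_integral_Pi_pmf_mult[OF W, where A = "S i" and B = "\<Union>j\<in>J. S j"])
    show "depends_on (\<Union>j\<in>J. S j) (\<lambda>y. \<Prod>j\<in>J. f j y)"
      by (rule depends_on_prod, rule depends_on_mono[OF insert.prems(3)]) auto
    show "S i \<inter> (\<Union>j\<in>J. S j) = {}"
      using insert.prems(2) insert.hyps by (fastforce simp: disjoint_family_on_def)
  qed (use insert.prems in auto)
  also have "(\<integral>\<^sup>+y. (\<Prod>j\<in>J. f j y) \<partial>Pi_pmf W d p) = (\<Prod>j\<in>J. nn_integral (Pi_pmf W d p) (f j))"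
    using insert.prems by (intro insert.IH) (auto intro: disjoint_family_on_mono)
  finally show ?case using insert.hyps by simp
qed simp

lemma nn_integral_Pi_pmf_component:
  assumes "finite W" "k \<in> W"
  shows "(\<integral>\<^sup>+y. f (y k) \<partial>Pi_pmf W d p) = nn_integral (p k) f"
  using Pi_pmf_component[OF assms(1), of k d p] assms(2)
  by (metis nn_integral_map_pmf)

text \<open>Two instances over the same inputs follow: the channel means themselves, and the means
  with the input at time 0 replaced by a real \<open>x\<close>.\<close>

locale poisson_mixture = prob_space \<mu> for \<mu> :: "'a measure" +
  fixes M :: "'k \<Rightarrow> 'a \<Rightarrow> real"
  assumes mean_measurable [measurable]: "\<And>k. M k \<in> borel_measurable \<mu>"
    and mean_pos: "\<And>k X. X \<in> space \<mu> \<Longrightarrow> M k X > 0"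
begin

text \<open>The Poisson probabilities are spelled out so that the integrand matches the mixture
  formula in \<open>output_law_cylinder\<close>.\<close>

definition weight :: "'k set \<Rightarrow> ('k \<Rightarrow> nat) \<Rightarrow> real" where
  "weight W y = (\<integral>X. (\<Prod>k\<in>W. exp (- M k X) * M k X ^ y k / fact (y k)) \<partial>\<mu>)"

abbreviation kernel :: "'k set \<Rightarrow> 'a \<Rightarrow> ('k \<Rightarrow> nat) pmf" where
  "kernel W X \<equiv> Pi_pmf W undefined (\<lambda>k. poisson_pmf (M k X))"

text \<open>\<open>weight W\<close> reads \<open>y\<close> on \<open>W\<close> only. Restricting to
  functions that are \<open>undefined\<close> elsewhere counts each output configuration
  once.\<close>

definition mix :: "'k set \<Rightarrow> ('k \<Rightarrow> nat) pmf" where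
  "mix W = embed_pmf (\<lambda>y. if y \<in> W \<rightarrow>\<^sub>E UNIV then weight W y else 0)"

lemma poisson_prod_bounds:
  assumes "X \<in> space \<mu>"
  shows "0 \<le> (\<Prod>k\<in>W. exp (- M k X) * M k X ^ y k / fact (y k))"
    "(\<Prod>k\<in>W. exp (- M k X) * M k X ^ y k / fact (y k)) \<le> 1"
proof -
  have *: "exp (- M k X) * M k X ^ y k / fact (y k) = pmf (poisson_pmf (M k X)) (y k)" for k
    using mean_pos[OF assms] by (simp add: mult_ac)
  show "0 \<le> (\<Prod>k\<in>W. exp (- M k X) * M k X ^ y k / fact (y k))"
    "(\<Prod>k\<in>W. exp (- M k X) * M k X ^ y k / fact (y k)) \<le> 1"
    unfolding * by (auto intro!: prod_nonneg prod_le_1 pmf_le_1)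
qed

lemma weight_nonneg: "0 \<le> weight W y"
  unfolding weight_def using poisson_prod_bounds by (intro Bochner_Integration.integral_nonneg)

lemma ennreal_weight:
  "ennreal (weight W y) = (\<integral>\<^sup>+X. ennreal (\<Prod>k\<in>W. exp (- M k X) * M k X ^ y k / fact (y k)) \<partial>\<mu>)"
  unfolding weight_def
  by (rule nn_integral_eq_integral[symmetric])
     (auto intro!: integrable_const_bound[where B = 1] poisson_prod_bounds AE_I2 simp: abs_of_nonneg poisson_prod_bounds)

lemma pmf_kernel:
  assumes "finite W" "X \<in> space \<mu>"
  shows "pmf (kernel W X) y =
    (if y \<in> W \<rightarrow>\<^sub>E UNIV then \<Prod>k\<in>W. exp (- M k X) * M k X ^ y k / fact (y k) else 0)"
  using assms mean_pos[OF assms(2)] by (auto simp: pmf_Pi PiE_iff extensional_def mult_ac)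

lemma nn_integral_weight:
  assumes W: "finite W"
  shows "(\<integral>\<^sup>+y. f y * ennreal (weight W y) \<partial>count_space (W \<rightarrow>\<^sub>E UNIV))
    = (\<integral>\<^sup>+X. \<integral>\<^sup>+y. f y \<partial>kernel W X \<partial>\<mu>)"
proof -
  let ?C = "count_space (W \<rightarrow>\<^sub>E (UNIV :: nat set))"
  let ?w = "\<lambda>X y. \<Prod>k\<in>W. exp (- M k X) * M k X ^ y k / fact (y k)"
  have cnt: "countable (W \<rightarrow>\<^sub>E (UNIV :: nat set))"
    using W by (intro countable_PiE) auto
  interpret C: sigma_finite_measure ?C
    using cnt by (rule sigma_finite_measure_count_space_countable)
  interpret P: pair_sigma_finite \<mu> ?C ..
  \<comment> \<open>The second component ranges over a countable discrete set, so measurability in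
    the inputs for each fixed \<open>y\<close> is enough for Fubini.\<close>
  have m: "(\<lambda>(X, y). f y * ennreal (?w X y)) \<in> borel_measurable (\<mu> \<Otimes>\<^sub>M ?C)"
    unfolding case_prod_beta
    by (rule measurable_compose_countable'[where I = "W \<rightarrow>\<^sub>E UNIV" and g = snd
          and f = "\<lambda>y p. f y * ennreal (?w (fst p) y)"]) (use cnt in measurable)
  have "(\<integral>\<^sup>+y. f y * ennreal (weight W y) \<partial>?C) = (\<integral>\<^sup>+y. \<integral>\<^sup>+X. f y * ennreal (?w X y) \<partial>\<mu> \<partial>?C)"
    by (intro nn_integral_cong) (simp add: ennreal_weight nn_integral_cmult)
  also have "\<dots> = (\<integral>\<^sup>+X. \<integral>\<^sup>+y. f y * ennreal (?w X y) \<partial>?C \<partial>\<mu>)"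
    by (rule P.Fubini'[OF m])
  also have "\<dots> = (\<integral>\<^sup>+X. \<integral>\<^sup>+y. f y \<partial>kernel W X \<partial>\<mu>)"
  proof (rule nn_integral_cong)
    fix X assume X: "X \<in> space \<mu>"
    have "(\<integral>\<^sup>+y. f y * ennreal (?w X y) \<partial>?C) =
      (\<integral>\<^sup>+y. f y * ennreal (?w X y) * indicator (W \<rightarrow>\<^sub>E UNIV) y \<partial>count_space UNIV)"
      by (simp add: nn_integral_count_space_indicator)
    also have "\<dots> = (\<integral>\<^sup>+y. ennreal (pmf (kernel W X) y) * f y \<partial>count_space UNIV)"
      by (intro nn_integral_cong) (auto simp: pmf_kernel[OF W X] mult_ac indicator_def)
    also have "\<dots> = (\<integral>\<^sup>+y. f y \<partial>kernel W X)"
      by (simp add: nn_integral_measure_pmf)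
    finally show "(\<integral>\<^sup>+y. f y * ennreal (?w X y) \<partial>?C) = (\<integral>\<^sup>+y. f y \<partial>kernel W X)" .
  qed
  finally show ?thesis .
qed

text \<open>That the weights have total mass 1 is the case \<open>f = 1\<close> of
  \<open>nn_integral_weight\<close>.\<close>

lemma pmf_mix:
  assumes W: "finite W"
  shows "pmf (mix W) y = (if y \<in> W \<rightarrow>\<^sub>E UNIV then weight W y else 0)"
  unfolding mix_def
proof (rule pmf_embed_pmf)
  have "(\<integral>\<^sup>+y. ennreal (if y \<in> W \<rightarrow>\<^sub>E UNIV then weight W y else 0) \<partial>count_space UNIV)
    = (\<integral>\<^sup>+y. 1 * ennreal (weight W y) \<partial>count_space (W \<rightarrow>\<^sub>E UNIV))"
    by (subst (2) nn_integral_count_space_indicator) (auto intro!: nn_integral_cong simp: indicator_def)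
  also have "\<dots> = 1"
    by (subst nn_integral_weight[OF W]) (simp add: emeasure_space_1)
  finally show "(\<integral>\<^sup>+y. ennreal (if y \<in> W \<rightarrow>\<^sub>E UNIV then weight W y else 0) \<partial>count_space UNIV) = 1" .
qed (simp add: weight_nonneg)

lemma nn_integral_mix:
  assumes W: "finite W"
  shows "nn_integral (mix W) f = (\<integral>\<^sup>+X. \<integral>\<^sup>+y. f y \<partial>kernel W X \<partial>\<mu>)"
proof -
  have "nn_integral (mix W) f = (\<integral>\<^sup>+y. f y * ennreal (weight W y) * indicator (W \<rightarrow>\<^sub>E UNIV) y \<partial>count_space UNIV)"
    unfolding nn_integral_measure_pmf
    by (intro nn_integral_cong) (auto simp: pmf_mix[OF W] mult_ac indicator_def)
  then show ?thesis
    by (simp add: nn_integral_weight[OF W, symmetric] nn_integral_count_space_indicator)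
qed

text \<open>Estimates are proved for fixed inputs, where the outputs are independent, and are
  carried over to the mixture by this lemma and the next.\<close>

lemma nn_integral_mix_le:
  assumes "finite W" "\<And>X. X \<in> space \<mu> \<Longrightarrow> nn_integral (kernel W X) f \<le> c"
  shows "nn_integral (mix W) f \<le> c"
proof -
  have "nn_integral (mix W) f \<le> (\<integral>\<^sup>+X. c \<partial>\<mu>)"
    unfolding nn_integral_mix[OF assms(1)] by (intro nn_integral_mono assms(2))
  then show ?thesis by (simp add: emeasure_space_1)
qed

lemma nn_integral_mix_ge:
  assumes "finite W" "\<And>X. X \<in> space \<mu> \<Longrightarrow> c \<le> nn_integral (kernel W X) f"
  shows "c \<le> nn_integral (mix W) f"
proof -
  have "(\<integral>\<^sup>+X. c \<partial>\<mu>) \<le> nn_integral (mix W) f"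
    unfolding nn_integral_mix[OF assms(1)] by (intro nn_integral_mono assms(2))
  then show ?thesis by (simp add: emeasure_space_1)
qed

text \<open>Consistency of the marginals holds for each kernel and survives averaging over the
  inputs. It lets windows of different lengths be compared inside the larger one.\<close>

lemma mix_subset:
  assumes W: "finite W" and V: "V \<subseteq> W"
  shows "mix V = map_pmf (\<lambda>y. restrict y V) (mix W)"
proof (rule pmf_eqI)
  fix y
  have fV: "finite V" using V W by (rule finite_subset)
  have "ennreal (pmf (mix V) y) = (\<integral>\<^sup>+X. emeasure (kernel V X) {y} \<partial>\<mu>)"
    using nn_integral_mix[OF fV, of "indicator {y}"] by (simp add: emeasure_pmf_single)
  also have "\<dots> = (\<integral>\<^sup>+X. \<integral>\<^sup>+u. indicator {y} (restrict u V) \<partial>kernel W X \<partial>\<mu>)"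
  proof (intro nn_integral_cong)
    fix X
    have "emeasure (kernel V X) {y} = (\<integral>\<^sup>+u. indicator {y} u \<partial>kernel V X)" by simp
    also have "\<dots> = (\<integral>\<^sup>+u. indicator {y} (restrict u V) \<partial>kernel W X)"
      unfolding Pi_pmf_subset[OF W V] nn_integral_map_pmf restrict_def by simp
    finally show "emeasure (kernel V X) {y} = (\<integral>\<^sup>+u. indicator {y} (restrict u V) \<partial>kernel W X)" .
  qed
  also have "\<dots> = (\<integral>\<^sup>+u. indicator {y} (restrict u V) \<partial>mix W)"
    by (rule nn_integral_mix[OF W, symmetric])
  also have "\<dots> = (\<integral>\<^sup>+u. indicator {y} u \<partial>map_pmf (\<lambda>y. restrict y V) (mix W))"
    by (simp only: nn_integral_map_pmf)
  also have "\<dots> = ennreal (pmf (map_pmf (\<lambda>y. restrict y V) (mix W)) y)"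
    unfolding emeasure_pmf_single[symmetric] by (subst nn_integral_indicator) auto
  finally show "pmf (mix V) y = pmf (map_pmf (\<lambda>y. restrict y V) (mix W)) y"
    by (simp add: pmf_nonneg)
qed

lemma expectation_mix_subset:
  fixes f :: "('k \<Rightarrow> nat) \<Rightarrow> real"
  assumes "finite W" "V \<subseteq> W" "depends_on V f"
  shows "measure_pmf.expectation (mix V) f = measure_pmf.expectation (mix W) f"
  unfolding mix_subset[OF assms(1,2)] integral_map_pmf
  by (intro Bochner_Integration.integral_cong refl depends_onD[OF assms(3)]) auto

text \<open>Links expectations to the unordered sums over output configurations by which
  \<open>Delta_trunc\<close> is defined.\<close>

lemma has_sum_mix:
  fixes f :: "('k \<Rightarrow> nat) \<Rightarrow> real"
  assumes W: "finite W" and f: "integrable (mix W) f"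
  shows "((\<lambda>y. f y * weight W y) has_sum measure_pmf.expectation (mix W) f) (W \<rightarrow>\<^sub>E UNIV)"
proof -
  let ?g = "\<lambda>y. pmf (mix W) y * f y"
  have abs: "Infinite_Set_Sum.abs_summable_on ?g UNIV"
    using f unfolding Infinite_Set_Sum.abs_summable_on_def measure_pmf_eq_density
    by (subst (asm) integrable_density) auto
  then have "?g summable_on UNIV"
    using abs_summable_equivalent abs_summable_summable by blast
  then have "(?g has_sum measure_pmf.expectation (mix W) f) UNIV"
    using infsetsum_infsum[OF abs] by (simp add: pmf_expectation_eq_infsetsum)
  then show ?thesis
    by (rule has_sum_cong_neutral[THEN iffD1, rotated -1]) (auto simp: pmf_mix[OF W])
qed

end

lemma mix_cong:
  assumes "poisson_mixture \<mu> M" "poisson_mixture \<mu> M'" "finite W"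
    and "\<And>k X. k \<in> W \<Longrightarrow> X \<in> space \<mu> \<Longrightarrow> M k X = M' k X"
  shows "poisson_mixture.mix \<mu> M W = poisson_mixture.mix \<mu> M' W"
proof -
  have "poisson_mixture.weight \<mu> M W y = poisson_mixture.weight \<mu> M' W y" for y
    unfolding poisson_mixture.weight_def[OF assms(1)] poisson_mixture.weight_def[OF assms(2)]
    using assms(4) by (intro Bochner_Integration.integral_cong refl prod.cong) auto
  then show ?thesis
    unfolding poisson_mixture.mix_def[OF assms(1)] poisson_mixture.mix_def[OF assms(2)] by (simp cong: if_cong)
qed

section \<open>Forgetting of the output filter\<close>

text \<open>Replacing the coordinates outside \<open>S\<close> by those of an independent copy does
  not change a product law. It suffices to test cylinders, and the preimage of a cylinder under the
  splicing map is a rectangle.\<close>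

lemma distr_splice_PiM:
  fixes M :: "'i \<Rightarrow> 'a measure"
  assumes M: "\<And>i. prob_space (M i)"
  shows "distr (PiM UNIV M \<Otimes>\<^sub>M PiM UNIV M) (PiM UNIV M) (\<lambda>(X, Y) i. if i \<in> S then X i else Y i)
    = PiM UNIV M" (is "?L = _")
proof (rule measure_eqI_PiM_infinite[symmetric, OF refl])
  interpret P: prob_space "PiM UNIV M" using M by (intro prob_space_PiM)
  show "finite_measure (PiM UNIV M)" by unfold_locales
  have meas: "(\<lambda>(X, Y) i. if i \<in> S then X i else Y i) \<in> PiM UNIV M \<Otimes>\<^sub>M PiM UNIV M \<rightarrow>\<^sub>M PiM UNIV M"
  proof (rule measurable_PiM_single')
    fix i
    show "(\<lambda>p. (case p of (X, Y) \<Rightarrow> \<lambda>i. if i \<in> S then X i else Y i) i) \<in> PiM UNIV M \<Otimes>\<^sub>M PiM UNIV M \<rightarrow>\<^sub>M M i"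
      by (cases "i \<in> S") (auto simp: case_prod_beta)
  qed (auto simp: space_pair_measure space_PiM PiE_iff)
  fix J A assume J: "finite J" and A: "\<And>i. i \<in> J \<Longrightarrow> A i \<in> sets (M i)"
  let ?X = "\<lambda>J. prod_emb UNIV M J (Pi\<^sub>E J A)"
  have "PiM UNIV M (?X J) = (\<Prod>i\<in>J. M i (A i))"
    using M J A by (intro emeasure_PiM_emb) auto
  also have "\<dots> = (\<Prod>i\<in>J \<inter> S. M i (A i)) * (\<Prod>i\<in>J - S. M i (A i))"
    using prod.Int_Diff[OF J] .
  also have "\<dots> = PiM UNIV M (?X (J \<inter> S)) * PiM UNIV M (?X (J - S))"
    using M J A by (intro arg_cong2[of _ _ _ _ "(*)"] emeasure_PiM_emb[symmetric]) auto
  also have "\<dots> = (PiM UNIV M \<Otimes>\<^sub>M PiM UNIV M) (?X (J \<inter> S) \<times> ?X (J - S))"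
    using J A by (intro P.emeasure_pair_measure_Times[symmetric] sets_PiM_I) auto
  also have "?X (J \<inter> S) \<times> ?X (J - S) =
      (\<lambda>(X, Y) i. if i \<in> S then X i else Y i) -` ?X J \<inter> space (PiM UNIV M \<Otimes>\<^sub>M PiM UNIV M)"
    by (auto simp: prod_emb_def space_pair_measure space_PiM PiE_iff split: if_splits)
  also have "(PiM UNIV M \<Otimes>\<^sub>M PiM UNIV M) \<dots> = ?L (?X J)"
    using J A by (intro emeasure_distr[symmetric] meas sets_PiM_I) auto
  finally show "PiM UNIV M (?X J) = ?L (?X J)" .
qed simp

section \<open>Bounded random variables and independence of disjoint sets of inputs\<close>

definition (in prob_space) bounded_rv :: "('a \<Rightarrow> real) \<Rightarrow> bool" where
  "bounded_rv f \<longleftrightarrow> f \<in> borel_measurable M \<and> (\<exists>b. \<forall>X\<in>space M. \<bar>f X\<bar> \<le> b)"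

context prob_space
begin

lemma bounded_rv_integrable:
  assumes "bounded_rv f"
  shows "integrable M f"
proof -
  from assms obtain b where "\<forall>X\<in>space M. \<bar>f X\<bar> \<le> b" by (auto simp: bounded_rv_def)
  then show ?thesis
    using assms by (intro integrable_const_bound[where B = b]) (auto simp: bounded_rv_def)
qed

lemma bounded_rv_const: "bounded_rv (\<lambda>_. c)"
  unfolding bounded_rv_def by auto

lemma bounded_rv_mult:
  assumes "bounded_rv f" "bounded_rv g"
  shows "bounded_rv (\<lambda>X. f X * g X)"
proof -
  from assms obtain b c where "\<forall>X\<in>space M. \<bar>f X\<bar> \<le> b" "\<forall>X\<in>space M. \<bar>g X\<bar> \<le> c"
    by (auto simp: bounded_rv_def)
  then have "\<forall>X\<in>space M. \<bar>f X * g X\<bar> \<le> b * c"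
    by (force simp: abs_mult intro!: mult_mono intro: order_trans[OF abs_ge_zero])
  then show ?thesis using assms by (auto simp: bounded_rv_def)
qed

lemma bounded_rv_diff:
  assumes "bounded_rv f" "bounded_rv g"
  shows "bounded_rv (\<lambda>X. f X - g X)"
proof -
  from assms obtain b c where *: "\<forall>X\<in>space M. \<bar>f X\<bar> \<le> b" "\<forall>X\<in>space M. \<bar>g X\<bar> \<le> c"
    by (auto simp: bounded_rv_def)
  have "\<forall>X\<in>space M. \<bar>f X - g X\<bar> \<le> b + c"
  proof
    fix X assume "X \<in> space M"
    then show "\<bar>f X - g X\<bar> \<le> b + c" using * abs_triangle_ineq4[of "f X" "g X"] by fastforce
  qed
  then show ?thesis using assms by (auto simp: bounded_rv_def)
qed

lemma bounded_rv_prod: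
  "(\<And>j. j \<in> J \<Longrightarrow> bounded_rv (f j)) \<Longrightarrow> bounded_rv (\<lambda>X. \<Prod>j\<in>J. f j X)"
  by (induction J rule: infinite_finite_induct) (auto intro: bounded_rv_const bounded_rv_mult)

end

text \<open>After splicing, \<open>f\<close> reads only the first copy and \<open>g\<close> only the
  second, so Fubini separates the two integrals.\<close>

lemma integral_PiM_mult_disjoint:
  fixes M :: "'i \<Rightarrow> 'a measure" and f g :: "('i \<Rightarrow> 'a) \<Rightarrow> real"
  assumes M: "\<And>i. prob_space (M i)"
    and f: "prob_space.bounded_rv (PiM UNIV M) f" "depends_on S f"
    and g: "prob_space.bounded_rv (PiM UNIV M) g" "depends_on (- S) g"
  shows "(\<integral>X. f X * g X \<partial>PiM UNIV M) = (\<integral>X. f X \<partial>PiM UNIV M) * (\<integral>X. g X \<partial>PiM UNIV M)"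
proof -
  let ?P = "PiM UNIV M"
  let ?s = "\<lambda>(X, Y) i. if i \<in> S then X i else Y i"
  interpret P: prob_space ?P using M by (intro prob_space_PiM)
  interpret PP: pair_prob_space ?P ?P ..
  have [measurable]: "f \<in> borel_measurable ?P" "g \<in> borel_measurable ?P"
    using f g by (auto simp: P.bounded_rv_def)
  from P.bounded_rv_mult[OF f(1) g(1)] have fg: "(\<lambda>X. f X * g X) \<in> borel_measurable ?P" by simp
  have smeas: "?s \<in> ?P \<Otimes>\<^sub>M ?P \<rightarrow>\<^sub>M ?P"
  proof (rule measurable_PiM_single')
    fix i
    show "(\<lambda>p. (case p of (X, Y) \<Rightarrow> \<lambda>i. if i \<in> S then X i else Y i) i) \<in> ?P \<Otimes>\<^sub>M ?P \<rightarrow>\<^sub>M M i"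
      by (cases "i \<in> S") (auto simp: case_prod_beta)
  qed (auto simp: space_pair_measure space_PiM PiE_iff)
  from f g obtain b c where bc: "\<forall>X\<in>space ?P. \<bar>f X\<bar> \<le> b" "\<forall>X\<in>space ?P. \<bar>g X\<bar> \<le> c"
    by (auto simp: P.bounded_rv_def)
  have int: "integrable (?P \<Otimes>\<^sub>M ?P) (\<lambda>(X, Y). f X * g Y)"
  proof (rule PP.P.integrable_const_bound[where B = "b * c"])
    show "AE p in ?P \<Otimes>\<^sub>M ?P. norm (case p of (X, Y) \<Rightarrow> f X * g Y) \<le> b * c"
      using bc by (intro AE_I2) (force simp: space_pair_measure abs_mult
        intro!: mult_mono intro: order_trans[OF abs_ge_zero])
  qed measurable
  have "(\<integral>X. f X * g X \<partial>?P) = (\<integral>X. f X * g X \<partial>distr (?P \<Otimes>\<^sub>M ?P) ?P ?s)"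
    using distr_splice_PiM[OF M, where S = S] by simp
  also have "\<dots> = (\<integral>p. f (?s p) * g (?s p) \<partial>(?P \<Otimes>\<^sub>M ?P))"
    by (rule integral_distr[OF smeas fg])
  also have "\<dots> = (\<integral>(X, Y). f X * g Y \<partial>(?P \<Otimes>\<^sub>M ?P))"
    by (intro Bochner_Integration.integral_cong refl)
       (auto intro!: arg_cong2[of _ _ _ _ "(*)"] depends_onD[OF f(2)] depends_onD[OF g(2)])
  also have "\<dots> = (\<integral>X. \<integral>Y. f X * g Y \<partial>?P \<partial>?P)"
    using PP.integral_fst[OF int] by simp
  finally show ?thesis by simp
qed

section \<open>The channel means, baseline and perturbed\<close>

locale isi_channel =
  fixes L :: nat and lam0 A :: real and h :: "nat \<Rightarrow> real" and F :: "real measure"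
  assumes lam0_pos: "lam0 > 0" and h_nonneg: "\<And>l. l \<le> L \<Longrightarrow> h l \<ge> 0"
    and h_sum: "(\<Sum>l\<le>L. h l) = 1" and A_nonneg: "A \<ge> 0"
    and F_law: "F \<in> space (prob_algebra (restrict_space borel {0..A}))"
begin

abbreviation inputs :: "(int \<Rightarrow> real) measure" where
  "inputs \<equiv> iid_inputs F"

abbreviation Z :: "int \<Rightarrow> (int \<Rightarrow> real) \<Rightarrow> real" where
  "Z k X \<equiv> channel_mean L lam0 h X k"

abbreviation Zx :: "real \<Rightarrow> int \<Rightarrow> (int \<Rightarrow> real) \<Rightarrow> real" where
  "Zx x k X \<equiv> channel_mean L lam0 h (X(0 := x)) k"

lemma prob_F: "prob_space F"
  using F_law by (simp add: space_prob_algebra)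

sublocale prob_space inputs
  unfolding iid_inputs_def using prob_F by (intro prob_space_PiM)

lemma space_inputs: "X \<in> space inputs \<longleftrightarrow> (\<forall>i. X i \<in> {0..A})"
proof -
  have "sets F = sets (restrict_space borel {0..A})"
    using F_law by (simp add: space_prob_algebra)
  then have "space F = {0..A}"
    by (simp add: sets_eq_imp_space_eq space_restrict_space)
  then show ?thesis by (simp add: iid_inputs_def space_PiM PiE_iff)
qed

lemma Z_measurable [measurable]: "Z k \<in> borel_measurable inputs"
  using output_kernel_measurable(3)[OF lam0_pos _ F_law, of L h k] h_nonneg by simp

lemma Z_eq: "channel_mean L lam0 h X k = lam0 + (\<Sum>l\<le>L. h l * X (k - int l))" for X :: "int \<Rightarrow> real"
  by (simp add: channel_mean_def)

lemma Z_lower: 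
  assumes "\<And>i. X i \<ge> 0"
  shows "lam0 \<le> channel_mean L lam0 h X k"
  unfolding Z_eq using h_nonneg assms by (auto intro!: sum_nonneg mult_nonneg_nonneg)

lemma Z_upper:
  assumes "\<And>i. X i \<le> b"
  shows "channel_mean L lam0 h X k \<le> lam0 + b"
proof -
  have "(\<Sum>l\<le>L. h l * X (k - int l)) \<le> (\<Sum>l\<le>L. h l * b)"
    using h_nonneg assms by (intro sum_mono mult_left_mono) auto
  also have "\<dots> = b" using h_sum by (simp flip: sum_distrib_right)
  finally show ?thesis unfolding Z_eq by simp
qed

lemma Z_bounds: "X \<in> space inputs \<Longrightarrow> lam0 \<le> Z k X" "X \<in> space inputs \<Longrightarrow> Z k X \<le> lam0 + A"
  using Z_lower[of X k] Z_upper[of X A k] by (auto simp: space_inputs)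

lemma Zx_unaffected:
  assumes "k < 0 \<or> int L < k"
  shows "Zx x k X = Z k X"
  unfolding Z_eq using assms by (intro arg_cong2[of _ _ _ _ "(+)"] sum.cong) auto

sublocale base: poisson_mixture inputs Z
  using Z_bounds(1) lam0_pos by unfold_locales (auto intro: less_le_trans)

lemma depends_on_Z: "depends_on {k - int L..k} (Z k)"
  unfolding Z_eq by (intro depends_onI arg_cong2[of _ _ _ _ "(+)"] sum.cong) auto

section \<open>Weights of observed outputs given the inputs\<close>

definition poisson_weight :: "(int \<Rightarrow> nat) \<Rightarrow> int \<Rightarrow> (int \<Rightarrow> real) \<Rightarrow> real" where
  "poisson_weight y k X = exp (- Z k X) * Z k X ^ y k / fact (y k)"

text \<open>This and \<open>weight_max\<close> bound the Poisson probability of \<open>n\<close>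
  over all means in \<open>[lam0, lam0 + A]\<close>, with the exponential and the power estimated
  separately.\<close>

definition weight_min :: "nat \<Rightarrow> real" where
  "weight_min n = exp (- (lam0 + A)) * lam0 ^ n / fact n"

definition weight_max :: "nat \<Rightarrow> real" where
  "weight_max n = exp (- lam0) * (lam0 + A) ^ n / fact n"

definition spread :: real where
  "spread = (lam0 + A) / lam0"

text \<open>The quotient of \<open>weight_min n\<close> by \<open>weight_max n\<close>: the
  minorisation constant that a single output \<open>n\<close> provides.\<close>

definition minor :: "nat \<Rightarrow> real" where
  "minor n = exp (- A) * inverse spread ^ n"

lemma spread_ge_1: "spread \<ge> 1"
  using lam0_pos A_nonneg by (simp add: spread_def)

lemma minor_bounds: "0 < minor n" "minor n \<le> 1"
proof -
  show "0 < minor n" using spread_ge_1 by (simp add: minor_def)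
  have "exp (- A) * inverse spread ^ n \<le> 1 * 1"
    using spread_ge_1 A_nonneg by (intro mult_mono power_le_one) (auto simp: inverse_le_1_iff)
  then show "minor n \<le> 1" by (simp add: minor_def)
qed

lemma weight_max_pos: "weight_max n > 0"
  using lam0_pos A_nonneg by (simp add: weight_max_def)

lemma weight_min_eq: "weight_min n = minor n * weight_max n"
proof -
  have "exp (- (lam0 + A)) = exp (- A) * exp (- lam0)" by (simp flip: exp_add)
  then show ?thesis using lam0_pos A_nonneg
    by (simp add: weight_min_def weight_max_def minor_def spread_def power_divide)
qed

lemma weight_min_pos: "weight_min n > 0"
  using weight_min_eq minor_bounds weight_max_pos by simp

lemma poisson_weight_bounds:
  assumes "X \<in> space inputs"
  shows "weight_min (y k) \<le> poisson_weight y k X" "poisson_weight y k X \<le> weight_max (y k)"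
  unfolding weight_min_def weight_max_def poisson_weight_def
  using Z_bounds[OF assms, of k] lam0_pos
  by (auto intro!: divide_right_mono mult_mono power_mono)

lemma depends_on_poisson_weight: "depends_on {k - int L..k} (poisson_weight y k)"
proof (rule depends_onI)
  fix X X' :: "int \<Rightarrow> real" assume "\<And>i. i \<in> {k - int L..k} \<Longrightarrow> X i = X' i"
  then have "Z k X = Z k X'" by (rule depends_onD[OF depends_on_Z])
  then show "poisson_weight y k X = poisson_weight y k X'" by (simp add: poisson_weight_def)
qed

definition path_weight :: "(int \<Rightarrow> nat) \<Rightarrow> int \<Rightarrow> int \<Rightarrow> (int \<Rightarrow> real) \<Rightarrow> real" where
  "path_weight y i s X = (\<Prod>k\<in>{i..<s}. poisson_weight y k X)"

lemma bounded_rv_poisson_weight: "bounded_rv (poisson_weight y k)"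
proof -
  have "poisson_weight y k \<in> borel_measurable inputs"
    unfolding poisson_weight_def by measurable
  moreover have "\<forall>X\<in>space inputs. \<bar>poisson_weight y k X\<bar> \<le> weight_max (y k)"
  proof
    fix X assume "X \<in> space inputs"
    then show "\<bar>poisson_weight y k X\<bar> \<le> weight_max (y k)"
      using poisson_weight_bounds[of X y k] weight_min_pos[of "y k"] by linarith
  qed
  ultimately show ?thesis by (auto simp: bounded_rv_def)
qed

lemma bounded_rv_path_weight: "bounded_rv (path_weight y i s)"
  unfolding path_weight_def by (intro bounded_rv_prod bounded_rv_poisson_weight)

lemma path_weight_bounds:
  assumes "X \<in> space inputs"
  shows "(\<Prod>k\<in>{i..<s}. weight_min (y k)) \<le> path_weight y i s X"
    "path_weight y i s X \<le> (\<Prod>k\<in>{i..<s}. weight_max (y k))"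
  unfolding path_weight_def
  by (intro prod_mono conjI poisson_weight_bounds[OF assms] less_imp_le[OF weight_min_pos]
      order_trans[OF less_imp_le[OF weight_min_pos] poisson_weight_bounds(1)[OF assms]])+

lemma path_weight_pos:
  assumes "X \<in> space inputs"
  shows "0 < path_weight y i s X"
  using path_weight_bounds(1)[OF assms] by (rule less_le_trans[rotated]) (simp add: prod_pos weight_min_pos)

lemma expectation_path_weight_pos: "0 < expectation (path_weight y i s)"
proof -
  have "0 < (\<Prod>k\<in>{i..<s}. weight_min (y k))" by (simp add: prod_pos weight_min_pos)
  also have "\<dots> \<le> expectation (path_weight y i s)"
    by (rule integral_ge_const[OF bounded_rv_integrable[OF bounded_rv_path_weight]])
       (auto intro: path_weight_bounds)
  finally show ?thesis .
qed

lemma depends_on_path_weight: "depends_on {i - int L..<s} (path_weight y i s)"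
  unfolding path_weight_def
  by (intro depends_on_prod, rule depends_on_mono[OF depends_on_poisson_weight]) auto

lemma path_weight_split: "i \<le> j \<Longrightarrow> j \<le> s \<Longrightarrow> path_weight y i s X = path_weight y i j X * path_weight y j s X"
  unfolding path_weight_def
  by (subst prod.union_disjoint[symmetric]) (auto simp: ivl_disj_un)

definition past :: "int \<Rightarrow> ((int \<Rightarrow> real) \<Rightarrow> real) set" where
  "past i = {K. bounded_rv K \<and> (\<forall>X\<in>space inputs. 0 \<le> K X) \<and> depends_on {..<i} K}"

text \<open>For every observed past, with whatever weight \<open>K\<close> it contributes, the conditional
  probability of \<open>y t\<close> given the outputs before time \<open>t\<close> lies in \<open>[lo, hi]\<close>.\<close>

definition filter_bounds :: "(int \<Rightarrow> nat) \<Rightarrow> int \<Rightarrow> int \<Rightarrow> real \<Rightarrow> real \<Rightarrow> bool" where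
  "filter_bounds y t i lo hi \<longleftrightarrow> (\<forall>K\<in>past i.
     lo * expectation (\<lambda>X. K X * path_weight y i t X) \<le> expectation (\<lambda>X. K X * path_weight y i (t + 1) X) \<and>
     expectation (\<lambda>X. K X * path_weight y i (t + 1) X) \<le> hi * expectation (\<lambda>X. K X * path_weight y i t X))"

text \<open>Blocks are numbered backwards from \<open>t\<close>. Their length \<open>L + 1\<close>
  is enough for the channel memory to run out across one block.\<close>

definition block :: "int \<Rightarrow> nat \<Rightarrow> int set" where
  "block t j = {t - int (Suc j) * int (Suc L)..<t - int j * int (Suc L)}"

definition block_minor :: "(int \<Rightarrow> nat) \<Rightarrow> int \<Rightarrow> nat \<Rightarrow> real" where
  "block_minor y t j = (\<Prod>k\<in>block t j. minor (y k))"

lemma block_minor_bounds: "0 < block_minor y t j" "block_minor y t j \<le> 1"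
  unfolding block_minor_def using minor_bounds by (auto intro!: prod_pos prod_le_1 simp: less_imp_le)

lemma filter_bounds_base: "filter_bounds y t t (weight_min (y t)) (weight_max (y t))"
  unfolding filter_bounds_def
proof
  fix K assume K: "K \<in> past t"
  have eq: "path_weight y t t = (\<lambda>_. 1)" "path_weight y t (t + 1) = poisson_weight y t"
    by (auto simp: path_weight_def fun_eq_iff atLeastLessThanPlusOne_atLeastAtMost_int)
  have b: "bounded_rv K" using K by (simp add: past_def)
  have int: "integrable inputs K" "integrable inputs (\<lambda>X. K X * poisson_weight y t X)"
    by (intro bounded_rv_integrable bounded_rv_mult b bounded_rv_poisson_weight)+
  have "expectation (\<lambda>X. weight_min (y t) * K X) \<le> expectation (\<lambda>X. K X * poisson_weight y t X)"
    using int K poisson_weight_bounds(1)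
    by (intro integral_mono) (auto simp: past_def mult.commute[of _ "K _"] intro!: mult_left_mono)
  moreover have "expectation (\<lambda>X. K X * poisson_weight y t X) \<le> expectation (\<lambda>X. weight_max (y t) * K X)"
    using int K poisson_weight_bounds(2)
    by (intro integral_mono) (auto simp: past_def mult.commute[of _ "K _"] intro!: mult_left_mono)
  ultimately show "weight_min (y t) * expectation (\<lambda>X. K X * path_weight y t t X)
      \<le> expectation (\<lambda>X. K X * path_weight y t (t + 1) X) \<and>
    expectation (\<lambda>X. K X * path_weight y t (t + 1) X)
      \<le> weight_max (y t) * expectation (\<lambda>X. K X * path_weight y t t X)"
    by (simp add: eq)
qed

text \<open>The conditional probability of \<open>y t\<close> given the outputs at times
  \<open>i\<close>, ..., \<open>t - 1\<close>, as a quotient of mixture weights.\<close>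

definition cond_weight :: "(int \<Rightarrow> nat) \<Rightarrow> int \<Rightarrow> int \<Rightarrow> real" where
  "cond_weight y i t = expectation (path_weight y i (t + 1)) / expectation (path_weight y i t)"

text \<open>Take for \<open>K\<close> the weight of the outputs from \<open>a\<close> up to
  \<open>i\<close>, which depends on inputs before \<open>i\<close> only.\<close>

lemma cond_weight_in_bounds:
  assumes "filter_bounds y t i lo hi" "a \<le> i" "i \<le> t"
  shows "lo \<le> cond_weight y a t" "cond_weight y a t \<le> hi"
proof -
  have "depends_on {..<i} (path_weight y a i)"
    by (rule depends_on_mono[OF depends_on_path_weight]) auto
  then have "path_weight y a i \<in> past i"
    using path_weight_pos bounded_rv_path_weight by (simp add: past_def less_imp_le)
  with assms(1) have "lo * expectation (path_weight y a t) \<le> expectation (path_weight y a (t + 1))"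
    "expectation (path_weight y a (t + 1)) \<le> hi * expectation (path_weight y a t)"
    unfolding filter_bounds_def using assms(2,3)
    by (auto simp flip: path_weight_split)
  then show "lo \<le> cond_weight y a t" "cond_weight y a t \<le> hi"
    unfolding cond_weight_def using expectation_path_weight_pos[of y a t]
    by (auto simp: pos_le_divide_eq pos_divide_le_eq)
qed

text \<open>Given the inputs before time \<open>i - L - 1\<close>, the weight of the outputs in between is at least
  \<open>minor\<close> times its maximum, whatever the inputs in between are. This part of the mixture forgets
  the past, since the inputs at times \<open>\<ge> i - L\<close> are independent of it.\<close>

lemma filter_bounds_step:
  fixes y t i
  defines "r \<equiv> cond_weight y i t" and "i' \<equiv> i - int (Suc L)"
  defines "\<epsilon> \<equiv> \<Prod>k\<in>{i'..<i}. minor (y k)"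
  assumes fb: "filter_bounds y t i lo hi" and it: "i \<le> t"
  shows "filter_bounds y t i' (lo + \<epsilon> * (r - lo)) (hi - \<epsilon> * (hi - r))"
  unfolding filter_bounds_def
proof
  fix K assume K: "K \<in> past i'"
  let ?V = "path_weight y i t" and ?V' = "path_weight y i (t + 1)" and ?G = "path_weight y i' i"
  define mlo where "mlo = (\<Prod>k\<in>{i'..<i}. weight_min (y k))"
  define mhi where "mhi = (\<Prod>k\<in>{i'..<i}. weight_max (y k))"
  have mlo: "mlo = \<epsilon> * mhi"
    by (simp add: mlo_def mhi_def \<epsilon>_def weight_min_eq prod.distrib)
  have pos: "mlo > 0" "mhi > 0" "\<epsilon> > 0"
    unfolding mlo_def mhi_def \<epsilon>_def by (auto intro!: prod_pos weight_min_pos weight_max_pos minor_bounds)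
  have G: "mlo \<le> ?G X" "?G X \<le> mhi" if "X \<in> space inputs" for X
    unfolding mlo_def mhi_def using path_weight_bounds[OF that] by auto
  have bK: "bounded_rv K" and K0: "\<And>X. X \<in> space inputs \<Longrightarrow> 0 \<le> K X" and dK: "depends_on {..<i'} K"
    using K by (auto simp: past_def)
  note b = bK bounded_rv_path_weight bounded_rv_mult bounded_rv_const bounded_rv_diff
  have r: "lo \<le> r" "r \<le> hi" unfolding r_def using cond_weight_in_bounds[OF fb order_refl it] by auto

  define a where "a = expectation (\<lambda>X. K X * ?V X)"
  define a' where "a' = expectation (\<lambda>X. K X * ?V' X)"
  define p where "p = expectation (\<lambda>X. K X * path_weight y i' t X)"
  define p' where "p' = expectation (\<lambda>X. K X * path_weight y i' (t + 1) X)"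

  \<comment> \<open>\<open>K\<close> reads inputs before \<open>i'\<close>, while the outputs from
    time \<open>i\<close> on read inputs from \<open>i - L\<close> on, which is later than
    \<open>i'\<close>.\<close>
  have indep: "expectation (\<lambda>X. K X * path_weight y i s X) = expectation K * expectation (path_weight y i s)" for s
    unfolding iid_inputs_def
  proof (rule integral_PiM_mult_disjoint[where S = "{..<i'}"])
    show "depends_on (- {..<i'}) (path_weight y i s)"
      by (rule depends_on_mono[OF depends_on_path_weight]) (auto simp: i'_def)
  qed (use prob_F dK bK bounded_rv_path_weight in \<open>auto simp: iid_inputs_def\<close>)
  have a': "a' = r * a"
    unfolding a_def a'_def indep r_def cond_weight_def using expectation_path_weight_pos[of y i t] by simp

  \<comment> \<open>The block weight \<open>?G\<close> is written as the constant \<open>mlo\<close>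
    plus a remainder. For the constant part the conditional probability is exactly \<open>r\<close>;
    the remainder is nonnegative, so multiplied by \<open>K\<close> it lies in \<open>past i\<close>
    and obeys the old bounds.\<close>
  have split: "expectation (\<lambda>X. K X * (?G X - mlo) * path_weight y i s X)
      = expectation (\<lambda>X. K X * path_weight y i' s X) - mlo * expectation (\<lambda>X. K X * path_weight y i s X)"
    if "i \<le> s" for s
  proof -
    have "expectation (\<lambda>X. K X * (?G X - mlo) * path_weight y i s X)
      = expectation (\<lambda>X. K X * path_weight y i' s X - mlo * (K X * path_weight y i s X))"
      using path_weight_split[of i' i s y] that
      by (intro Bochner_Integration.integral_cong refl) (simp add: i'_def algebra_simps)
    also have "\<dots> = expectation (\<lambda>X. K X * path_weight y i' s X) - expectation (\<lambda>X. mlo * (K X * path_weight y i s X))"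
      by (intro Bochner_Integration.integral_diff bounded_rv_integrable b)
    finally show ?thesis by simp
  qed
  have "(\<lambda>X. K X * (?G X - mlo)) \<in> past i"
    unfolding past_def
  proof safe
    show "bounded_rv (\<lambda>X. K X * (?G X - mlo))" by (intro b)
    show "depends_on {..<i} (\<lambda>X. K X * (?G X - mlo))"
      by (rule depends_on_compose2, rule depends_on_mono[OF dK], simp add: i'_def,
          rule depends_on_mono[OF depends_on_path_weight], auto)
  qed (use K0 G in auto)
  with fb have q: "lo * (p - mlo * a) \<le> p' - mlo * a'" "p' - mlo * a' \<le> hi * (p - mlo * a)"
    unfolding filter_bounds_def using it by (auto simp: split a_def a'_def p_def p'_def)

  \<comment> \<open>The constant part \<open>mlo * a\<close> carries at least the fraction
    \<epsilon> of the total mass \<open>p\<close>, because \<open>?G\<close> is at most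
    \<open>mhi\<close>.\<close>
  have "p \<le> expectation (\<lambda>X. mhi * (K X * ?V X))"
    unfolding p_def
  proof (rule integral_mono)
    fix X assume X: "X \<in> space inputs"
    have "K X * ?V X * ?G X \<le> K X * ?V X * mhi"
      using G[OF X] K0[OF X] path_weight_pos[OF X] by (intro mult_left_mono) (auto simp: less_imp_le)
    then show "K X * path_weight y i' t X \<le> mhi * (K X * ?V X)"
      using path_weight_split[of i' i t y] it by (simp add: i'_def mult_ac)
  qed (intro bounded_rv_integrable b)+
  then have "\<epsilon> * p \<le> \<epsilon> * (mhi * a)"
    using pos by (simp add: a_def)
  then have pa: "\<epsilon> * p \<le> mlo * a" by (simp add: mlo)
  \<comment> \<open>So \<open>p'\<close> is a mixture of \<open>r\<close> and a value in
    \<open>[lo, hi]\<close>, with proportion at least \<epsilon> on \<open>r\<close>; both ends move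
    towards \<open>r\<close> accordingly.\<close>
  have "(r - lo) * (\<epsilon> * p) \<le> (r - lo) * (mlo * a)" "(hi - r) * (\<epsilon> * p) \<le> (hi - r) * (mlo * a)"
    using r pa by (auto intro!: mult_left_mono)
  then have "(lo + \<epsilon> * (r - lo)) * p \<le> p'" "p' \<le> (hi - \<epsilon> * (hi - r)) * p"
    using q unfolding a' by (simp_all add: algebra_simps)
  then show "(lo + \<epsilon> * (r - lo)) * expectation (\<lambda>X. K X * path_weight y i' t X)
      \<le> expectation (\<lambda>X. K X * path_weight y i' (t + 1) X) \<and>
    expectation (\<lambda>X. K X * path_weight y i' (t + 1) X)
      \<le> (hi - \<epsilon> * (hi - r)) * expectation (\<lambda>X. K X * path_weight y i' t X)"
    by (simp add: p_def p'_def)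
qed

text \<open>Iterates \<open>filter_bounds_step\<close> over the blocks. Each end moves towards
  \<open>r\<close> by the fraction \<open>block_minor y t J\<close> of its distance to
  \<open>r\<close>, so the width is multiplied by \<open>1 - block_minor y t J\<close>.\<close>

lemma filter_forgetting:
  "\<exists>lo hi. weight_min (y t) \<le> lo \<and> lo \<le> hi \<and> hi \<le> weight_max (y t) \<and>
    hi - lo \<le> weight_max (y t) * (\<Prod>j<J. 1 - block_minor y t j) \<and>
    filter_bounds y t (t - int J * int (Suc L)) lo hi"
proof (induction J)
  case 0
  have "weight_min (y t) \<le> weight_max (y t)"
    using minor_bounds[of "y t"] weight_max_pos[of "y t"] by (simp add: weight_min_eq)
  then show ?case
    using filter_bounds_base[of y t] weight_min_pos[of "y t"]
    by (intro exI[of _ "weight_min (y t)"] exI[of _ "weight_max (y t)"]) auto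
next
  case (Suc J)
  then obtain lo hi where *: "weight_min (y t) \<le> lo" "lo \<le> hi" "hi \<le> weight_max (y t)"
    "hi - lo \<le> weight_max (y t) * (\<Prod>j<J. 1 - block_minor y t j)"
    "filter_bounds y t (t - int J * int (Suc L)) lo hi" by blast
  define i where "i = t - int J * int (Suc L)"
  define r where "r = cond_weight y i t"
  define \<epsilon> where "\<epsilon> = block_minor y t J"
  have i: "i \<le> t" by (simp add: i_def)
  have r: "lo \<le> r" "r \<le> hi"
    unfolding r_def using cond_weight_in_bounds[OF _ order_refl i] *(5) by (auto simp: i_def)
  have \<epsilon>: "0 < \<epsilon>" "\<epsilon> \<le> 1" using block_minor_bounds by (auto simp: \<epsilon>_def)
  have eq: "i - int (Suc L) = t - int (Suc J) * int (Suc L)"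
    by (simp add: i_def algebra_simps)
  have fb: "filter_bounds y t (t - int (Suc J) * int (Suc L)) (lo + \<epsilon> * (r - lo)) (hi - \<epsilon> * (hi - r))"
    using filter_bounds_step[OF *(5)[folded i_def] i]
    unfolding eq r_def[symmetric] by (simp add: \<epsilon>_def block_minor_def block_def i_def)
  have "hi - \<epsilon> * (hi - r) - (lo + \<epsilon> * (r - lo)) = (hi - lo) * (1 - \<epsilon>)" by (simp add: algebra_simps)
  moreover have "(hi - lo) * (1 - \<epsilon>) \<le> weight_max (y t) * (\<Prod>j<J. 1 - block_minor y t j) * (1 - \<epsilon>)"
    using *(4) \<epsilon> by (intro mult_right_mono) auto
  moreover have "0 \<le> \<epsilon> * (r - lo)" "0 \<le> \<epsilon> * (hi - r)" "0 \<le> (hi - lo) * (1 - \<epsilon>)" using \<epsilon> r * by auto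
  ultimately show ?case using * fb
    by (intro exI[of _ "lo + \<epsilon> * (r - lo)"] exI[of _ "hi - \<epsilon> * (hi - r)"]) (auto simp: \<epsilon>_def mult.assoc)
qed

lemma cond_weight_bounds:
  assumes "a \<le> t"
  shows "weight_min (y t) \<le> cond_weight y a t" "cond_weight y a t \<le> weight_max (y t)"
  using cond_weight_in_bounds[OF filter_bounds_base assms order_refl] by auto

text \<open>Both conditional probabilities lie in the same interval \<open>[lo, hi]\<close>, above
  \<open>weight_min (y t)\<close>, where the logarithm has Lipschitz constant
  \<open>1 / weight_min (y t)\<close>. The factor \<open>exp A * spread ^ y t\<close> is
  \<open>weight_max (y t) / weight_min (y t)\<close>.\<close>

lemma ln_cond_weight_diff:
  assumes "a \<le> t - int J * int (Suc L)" "b \<le> t - int J * int (Suc L)"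
  shows "\<bar>ln (cond_weight y a t) - ln (cond_weight y b t)\<bar>
    \<le> exp A * spread ^ y t * (\<Prod>j<J. 1 - block_minor y t j)"
proof -
  obtain lo hi where *: "weight_min (y t) \<le> lo"
    "hi - lo \<le> weight_max (y t) * (\<Prod>j<J. 1 - block_minor y t j)"
    "filter_bounds y t (t - int J * int (Suc L)) lo hi" using filter_forgetting by blast
  have one_sided: "ln p - ln q \<le> (hi - lo) / weight_min (y t)"
    if "lo \<le> q" "p \<le> hi" "lo \<le> p" for p q
  proof -
    have pos: "0 < p" "0 < q" "0 < lo" using that * weight_min_pos[of "y t"] by linarith+
    then have "ln p - ln q = ln (p / q)" by (simp add: ln_div)
    also have "\<dots> \<le> p / q - 1" using pos by (intro ln_le_minus_one) simp
    also have "\<dots> \<le> hi / lo - 1" using that pos by (intro diff_right_mono frac_le) auto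
    also have "\<dots> = (hi - lo) / lo" using pos by (simp add: diff_divide_distrib)
    also have "\<dots> \<le> (hi - lo) / weight_min (y t)"
      using * that weight_min_pos[of "y t"] by (intro divide_left_mono) auto
    finally show ?thesis .
  qed
  have in_bounds: "lo \<le> cond_weight y c t" "cond_weight y c t \<le> hi" if "c \<le> t - int J * int (Suc L)" for c
    using cond_weight_in_bounds[OF *(3) that] by auto
  have "\<bar>ln (cond_weight y a t) - ln (cond_weight y b t)\<bar> \<le> (hi - lo) / weight_min (y t)"
    unfolding abs_le_iff minus_diff_eq
    using one_sided in_bounds assms by blast
  also have "\<dots> \<le> weight_max (y t) * (\<Prod>j<J. 1 - block_minor y t j) / weight_min (y t)"
    using *(2) weight_min_pos by (intro divide_right_mono) (auto intro: less_imp_le)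
  also have "\<dots> = exp A * spread ^ y t * (\<Prod>j<J. 1 - block_minor y t j)"
    unfolding weight_min_eq minor_def using weight_max_pos[of "y t"] spread_ge_1
    by (simp add: field_simps exp_minus power_inverse)
  finally show ?thesis .
qed

end

section \<open>Poisson moments\<close>

lemma nn_integral_poisson:
  assumes "\<zeta> > 0" "\<And>n. f n \<ge> 0" "(\<lambda>n. \<zeta> ^ n / fact n * exp (- \<zeta>) * f n) sums S"
  shows "(\<integral>\<^sup>+n. ennreal (f n) \<partial>poisson_pmf \<zeta>) = ennreal S"
proof -
  have "(\<integral>\<^sup>+n. ennreal (f n) \<partial>poisson_pmf \<zeta>) = (\<Sum>n. ennreal (\<zeta> ^ n / fact n * exp (- \<zeta>) * f n))"
    using assms(1,2) by (simp add: nn_integral_measure_pmf nn_integral_count_space_nat flip: ennreal_mult)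
  also have "\<dots> = ennreal S"
    using assms by (intro suminf_ennreal_eq) auto
  finally show ?thesis .
qed

text \<open>The generating function is used at \<open>exp 1\<close> for integrability, at
  \<open>spread\<close> for the Lipschitz factor and at \<open>inverse spread\<close> for the
  minorisation constants.\<close>

lemma poisson_mgf:
  assumes "\<zeta> > 0" "s \<ge> 0"
  shows "(\<integral>\<^sup>+n. ennreal (s ^ n) \<partial>poisson_pmf \<zeta>) = ennreal (exp (\<zeta> * (s - 1)))"
proof (rule nn_integral_poisson)
  have "(\<lambda>n. exp (- \<zeta>) * ((\<zeta> * s) ^ n /\<^sub>R fact n)) sums (exp (- \<zeta>) * exp (\<zeta> * s))"
    by (intro sums_mult exp_converges)
  also have "exp (- \<zeta>) * exp (\<zeta> * s) = exp (\<zeta> * (s - 1))"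
    by (simp add: algebra_simps flip: exp_add)
  finally show "(\<lambda>n. \<zeta> ^ n / fact n * exp (- \<zeta>) * s ^ n) sums exp (\<zeta> * (s - 1))"
    by (simp add: power_mult_distrib divide_inverse mult_ac)
qed (use assms in auto)

lemma poisson_weight_sums: "(\<lambda>n. \<zeta> ^ n / fact n * exp (- \<zeta>)) sums (1 :: real)"
proof -
  have "(\<lambda>n. exp (- \<zeta>) * (\<zeta> ^ n /\<^sub>R fact n)) sums (exp (- \<zeta>) * exp \<zeta>)"
    by (intro sums_mult exp_converges)
  then show ?thesis by (simp add: divide_inverse mult_ac flip: exp_add)
qed

text \<open>The factor \<open>n\<close> cancels against the factorial; what remains is the series of
  total mass, shifted by one index and multiplied by the mean.\<close>

lemma poisson_mean_sums: "(\<lambda>n. \<zeta> ^ n / fact n * exp (- \<zeta>) * real n) sums \<zeta>"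
proof -
  have eq: "\<zeta> * (\<zeta> ^ n / fact n * exp (- \<zeta>)) = \<zeta> ^ Suc n / fact (Suc n) * exp (- \<zeta>) * real (Suc n)" for n
    by (simp add: divide_simps del: of_nat_Suc)
  show ?thesis
    using sums_mult[OF poisson_weight_sums[of \<zeta>], of \<zeta>] unfolding eq
    by (subst (asm) sums_Suc_iff) simp
qed

lemma poisson_second_moment_sums:
  "(\<lambda>n. \<zeta> ^ n / fact n * exp (- \<zeta>) * (real n)\<^sup>2) sums (\<zeta>\<^sup>2 + \<zeta>)"
proof -
  have eq: "\<zeta> * (\<zeta> ^ n / fact n * exp (- \<zeta>) * real n + \<zeta> ^ n / fact n * exp (- \<zeta>))
      = \<zeta> ^ Suc n / fact (Suc n) * exp (- \<zeta>) * (real (Suc n))\<^sup>2" for n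
    by (simp add: divide_simps power2_eq_square) (simp add: algebra_simps)
  show ?thesis
    using sums_mult[OF sums_add[OF poisson_mean_sums[of \<zeta>] poisson_weight_sums[of \<zeta>]], of \<zeta>] unfolding eq
    by (subst (asm) sums_Suc_iff) (simp add: algebra_simps power2_eq_square)
qed

lemma ln_fact_le_square: "ln (fact n :: real) \<le> (real n)\<^sup>2"
proof (cases "n = 0")
  case False
  have "ln (fact n :: real) \<le> ln (real n ^ n)"
    using fact_le_power[of n, where 'a = real] False by (intro ln_mono) auto
  also have "\<dots> = real n * ln (real n)" using False by (simp add: ln_realpow)
  also have "\<dots> \<le> real n * real n"
    using ln_bound[of "real n"] False by (intro mult_left_mono) auto
  finally show ?thesis by (simp add: power2_eq_square)
qed simp

text \<open>A single term of the exponential series is at most its sum. The choice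
  \<open>s = x\<close> will produce the growth \<open>x ln x\<close>.\<close>

lemma ln_fact_ge:
  assumes "s > 0"
  shows "real n * ln s - s \<le> ln (fact n :: real)"
proof -
  have "(\<lambda>n. s ^ n / fact n) sums exp s"
    using exp_converges[of s] by (simp add: divide_inverse mult_ac)
  then have "sum (\<lambda>n. s ^ n / fact n) {n} \<le> exp s"
    using assms sum_le_suminf[of "\<lambda>n. s ^ n / fact n" "{n}"] by (auto simp: sums_iff)
  then have "s ^ n / fact n \<le> exp s" by simp
  then have "ln (s ^ n / fact n) \<le> s" using assms
    by (metis exp_gt_zero fact_gt_zero ln_exp ln_mono zero_less_divide_iff zero_less_power)
  then show ?thesis using assms by (simp add: ln_div ln_realpow)
qed

text \<open>Turns polynomial bounds in an output into exponential ones, so that a single generating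
  function controls them all.\<close>

lemma quadratic_le_exp:
  fixes a b c :: real
  assumes "0 \<le> a" "0 \<le> b" "0 \<le> c"
  shows "a + b * real n + c * (real n)\<^sup>2 \<le> (a + b + 2 * c) * exp (real n)"
proof -
  have "1 + real n + (real n)\<^sup>2 / 2 \<le> exp (real n)" by (rule exp_lower_Taylor_quadratic) simp
  then have "1 \<le> exp (real n)" "real n \<le> exp (real n)" "(real n)\<^sup>2 \<le> 2 * exp (real n)"
    using zero_le_power2[of "real n"] by linarith+
  then have "a * 1 + b * real n + c * (real n)\<^sup>2 \<le> a * exp (real n) + b * exp (real n) + c * (2 * exp (real n))"
    using assms by (intro add_mono mult_left_mono) auto
  then show ?thesis by (simp add: algebra_simps)
qed

lemma (in poisson_mixture) integrable_mix_exp_bound: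
  assumes W: "finite W" "k \<in> W" and M: "\<And>X. X \<in> space \<mu> \<Longrightarrow> M k X \<le> D"
    and f: "\<And>y. \<bar>f y\<bar> \<le> C * exp (real (y k))"
  shows "integrable (mix W) f" "\<bar>measure_pmf.expectation (mix W) f\<bar> \<le> C * exp (D * (exp 1 - 1))"
proof -
  have C: "C \<ge> 0" using f[of "\<lambda>_. 0"] by simp
  have "(\<integral>\<^sup>+y. ennreal \<bar>f y\<bar> \<partial>mix W) \<le> ennreal (C * exp (D * (exp 1 - 1)))"
  proof (rule nn_integral_mix_le[OF W(1)])
    fix X assume X: "X \<in> space \<mu>"
    have "(\<integral>\<^sup>+y. ennreal \<bar>f y\<bar> \<partial>kernel W X) \<le> (\<integral>\<^sup>+y. ennreal C * ennreal (exp 1 ^ y k) \<partial>kernel W X)"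
      using f C by (intro nn_integral_mono) (simp add: exp_of_nat_mult flip: ennreal_mult exp_of_nat2_mult)
    also have "\<dots> = ennreal C * (\<integral>\<^sup>+n. ennreal (exp 1 ^ n) \<partial>poisson_pmf (M k X))"
      using nn_integral_Pi_pmf_component[OF W, where f = "\<lambda>n. ennreal (exp 1 ^ n)"] by (simp add: nn_integral_cmult)
    also have "\<dots> = ennreal (C * exp (M k X * (exp 1 - 1)))"
      using mean_pos[OF X] C by (simp add: poisson_mgf ennreal_mult)
    also have "\<dots> \<le> ennreal (C * exp (D * (exp 1 - 1)))"
      using C M[OF X] by (intro ennreal_leI mult_left_mono) (auto intro!: mult_right_mono)
    finally show "(\<integral>\<^sup>+y. ennreal \<bar>f y\<bar> \<partial>kernel W X) \<le> ennreal (C * exp (D * (exp 1 - 1)))" .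
  qed
  note bound = this
  show int: "integrable (mix W) f"
    using bound by (intro integrableI_bounded) (auto simp: top.extremum_strict intro: le_less_trans)
  have "\<bar>measure_pmf.expectation (mix W) f\<bar> \<le> measure_pmf.expectation (mix W) (\<lambda>y. \<bar>f y\<bar>)"
    by (rule integral_abs_bound)
  moreover have "ennreal (measure_pmf.expectation (mix W) (\<lambda>y. \<bar>f y\<bar>)) \<le> ennreal (C * exp (D * (exp 1 - 1)))"
    using bound int by (subst nn_integral_eq_integral[symmetric]) auto
  then have "measure_pmf.expectation (mix W) (\<lambda>y. \<bar>f y\<bar>) \<le> C * exp (D * (exp 1 - 1))"
    using C by (simp add: ennreal_le_iff)
  ultimately show "\<bar>measure_pmf.expectation (mix W) f\<bar> \<le> C * exp (D * (exp 1 - 1))"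
    by (rule order_trans)
qed

section \<open>Expected contraction over the blocks\<close>

context isi_channel
begin

text \<open>One minus the least expected \<open>block_minor\<close> over output means at most
  \<open>lam0 + A\<close>: each of the \<open>L + 1\<close> factors is \<open>exp (- A)\<close>
  times the Poisson generating function at \<open>inverse spread\<close>.\<close>

definition rate :: real where
  "rate = 1 - (exp (- A) * exp ((lam0 + A) * (inverse spread - 1))) ^ Suc L"

lemma rate_bounds: "0 \<le> rate" "rate < 1"
proof -
  have "exp (- A) * exp ((lam0 + A) * (inverse spread - 1)) \<le> 1 * 1"
    using A_nonneg lam0_pos spread_ge_1
    by (intro mult_mono) (auto simp: mult_le_0_iff inverse_le_1_iff)
  then show "0 \<le> rate" unfolding rate_def by (simp add: power_le_one del: power_Suc)
  show "rate < 1" unfolding rate_def by (simp del: power_Suc)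
qed

lemma block_subset: "j < J \<Longrightarrow> block t j \<subseteq> {t - int J * int (Suc L)..<t}"
proof -
  assume "j < J"
  then have "int (Suc j) * int (Suc L) \<le> int J * int (Suc L)" by (intro mult_right_mono) auto
  moreover have "0 \<le> int j * int (Suc L)" by simp
  ultimately show ?thesis unfolding block_def by (auto simp del: of_nat_Suc)
qed

lemma disjoint_blocks: "disjoint_family (block t)"
proof -
  have "block t i \<inter> block t j = {}" if "i < j" for i j
    using block_subset[OF that, of t] by (auto simp: block_def)
  then show ?thesis unfolding disjoint_family_on_def by (metis inf_commute nat_neq_iff)
qed

lemma card_block: "card (block t j) = Suc L"
  by (simp add: block_def algebra_simps)

lemma finite_block [simp]: "finite (block t j)"
  by (simp add: block_def)

lemma depends_on_block_minor: "depends_on (block t j) (\<lambda>y. block_minor y t j)"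
  unfolding block_minor_def by (intro depends_onI prod.cong) auto

text \<open>The outputs are independent for fixed means, so the expected \<open>block_minor\<close>
  is a product of generating functions at \<open>inverse spread\<close>. As this point is at most 1,
  each factor decreases in the mean and is smallest at \<open>lam0 + A\<close>.\<close>

lemma nn_integral_block_minor:
  assumes W: "finite W" "block t j \<subseteq> W" and z: "\<And>k. k \<in> block t j \<Longrightarrow> 0 < \<zeta> k \<and> \<zeta> k \<le> lam0 + A"
  shows "(\<integral>\<^sup>+y. ennreal (1 - block_minor y t j) \<partial>Pi_pmf W d (\<lambda>k. poisson_pmf (\<zeta> k))) \<le> ennreal rate"
proof -
  let ?P = "Pi_pmf W d (\<lambda>k. poisson_pmf (\<zeta> k))"
  let ?e = "\<lambda>k. exp (- A) * exp (\<zeta> k * (inverse spread - 1))"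
  have "(\<integral>\<^sup>+y. ennreal (block_minor y t j) \<partial>?P) = (\<integral>\<^sup>+y. (\<Prod>k\<in>block t j. ennreal (minor (y k))) \<partial>?P)"
    unfolding block_minor_def using minor_bounds by (simp add: prod_ennreal less_imp_le)
  also have "\<dots> = (\<Prod>k\<in>block t j. \<integral>\<^sup>+y. ennreal (minor (y k)) \<partial>?P)"
    using W by (intro nn_integral_Pi_pmf_disjoint_prod[where S = "\<lambda>k. {k}"])
      (auto simp: disjoint_family_on_def intro!: depends_onI)
  also have "\<dots> = (\<Prod>k\<in>block t j. ennreal (?e k))"
  proof (rule prod.cong[OF refl])
    fix k assume k: "k \<in> block t j"
    have "(\<integral>\<^sup>+y. ennreal (minor (y k)) \<partial>?P) = (\<integral>\<^sup>+n. ennreal (exp (- A)) * ennreal (inverse spread ^ n) \<partial>poisson_pmf (\<zeta> k))"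
      using nn_integral_Pi_pmf_component[OF W(1), where k = k and f = "\<lambda>n. ennreal (minor n)"] k W(2) spread_ge_1
      by (auto simp: minor_def ennreal_mult)
    also have "\<dots> = ennreal (?e k)"
      using z[OF k] spread_ge_1 by (simp add: nn_integral_cmult poisson_mgf ennreal_mult)
    finally show "(\<integral>\<^sup>+y. ennreal (minor (y k)) \<partial>?P) = ennreal (?e k)" .
  qed
  also have "\<dots> = ennreal (\<Prod>k\<in>block t j. ?e k)" by (simp add: prod_ennreal)
  finally have bm: "(\<integral>\<^sup>+y. ennreal (block_minor y t j) \<partial>?P) = ennreal (\<Prod>k\<in>block t j. ?e k)" .
  have "(\<integral>\<^sup>+y. ennreal (1 - block_minor y t j) \<partial>?P) + (\<integral>\<^sup>+y. ennreal (block_minor y t j) \<partial>?P)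
    = (\<integral>\<^sup>+y. 1 \<partial>?P)"
    using block_minor_bounds[of _ t j]
    by (subst nn_integral_add[symmetric])
       (auto intro!: nn_integral_cong simp: less_imp_le simp flip: ennreal_plus ennreal_1)
  \<comment> \<open>The complementary expectation is read off from the total mass 1, which avoids
    subtracting extended reals.\<close>
  then have eq: "(\<integral>\<^sup>+y. ennreal (1 - block_minor y t j) \<partial>?P) + ennreal (\<Prod>k\<in>block t j. ?e k) = 1"
    by (simp add: bm)
  have "(\<Prod>k\<in>block t j. exp (- A) * exp ((lam0 + A) * (inverse spread - 1))) \<le> (\<Prod>k\<in>block t j. ?e k)"
    using z spread_ge_1 by (intro prod_mono) (auto simp: inverse_le_1_iff intro!: mult_right_mono_neg)
  then have "1 - (\<Prod>k\<in>block t j. ?e k) \<le> rate" unfolding rate_def by (simp add: card_block del: power_Suc)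
  moreover have "(\<integral>\<^sup>+y. ennreal (1 - block_minor y t j) \<partial>?P) = ennreal (1 - (\<Prod>k\<in>block t j. ?e k))"
  proof (cases "\<integral>\<^sup>+y. ennreal (1 - block_minor y t j) \<partial>?P")
    case (real r)
    then have "ennreal (r + (\<Prod>k\<in>block t j. ?e k)) = ennreal 1"
      using eq by (simp add: prod_nonneg)
    then show ?thesis using real
      by (subst (asm) ennreal_inj) (auto simp: prod_nonneg algebra_simps)
  qed (use eq in simp)
  ultimately show ?thesis by (simp add: ennreal_leI)
qed

text \<open>Blocks \<open>j < j0\<close> may overlap the outputs affected by the perturbed input; they contribute a
  factor of at most 1.\<close>

lemma nn_integral_forgetting:
  assumes W: "finite W" "{t - int J * int (Suc L)..t} \<subseteq> W" and t: "0 < \<zeta> t" "\<zeta> t \<le> D"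
    and z: "\<And>j k. j0 \<le> j \<Longrightarrow> j < J \<Longrightarrow> k \<in> block t j \<Longrightarrow> 0 < \<zeta> k \<and> \<zeta> k \<le> lam0 + A"
  shows "(\<integral>\<^sup>+y. ennreal (exp A * spread ^ y t * (\<Prod>j<J. 1 - block_minor y t j))
      \<partial>Pi_pmf W d (\<lambda>k. poisson_pmf (\<zeta> k))) \<le> ennreal (exp A * exp (D * (spread - 1)) * rate ^ (J - j0))"
proof -
  let ?P = "Pi_pmf W d (\<lambda>k. poisson_pmf (\<zeta> k))"
  let ?p = "\<lambda>y. \<Prod>j<J. ennreal (1 - block_minor y t j)"
  have tW: "t \<in> W" using W(2) by auto
  have ltW: "{t - int J * int (Suc L)..<t} \<subseteq> W"
    using W(2) by (rule order_trans[rotated]) auto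
  have bW: "block t j \<subseteq> W" if "j < J" for j
    using block_subset[OF that] ltW by (rule order_trans)
  have s: "spread \<ge> 0" using spread_ge_1 by simp
  have "(\<integral>\<^sup>+y. ennreal (exp A * spread ^ y t * (\<Prod>j<J. 1 - block_minor y t j)) \<partial>?P)
    = (\<integral>\<^sup>+y. ennreal (exp A) * ennreal (spread ^ y t) * ?p y \<partial>?P)"
    using block_minor_bounds s by (simp add: ennreal_mult prod_ennreal prod_nonneg)
  also have "\<dots> = (\<integral>\<^sup>+y. ennreal (exp A) * ennreal (spread ^ y t) \<partial>?P) * (\<integral>\<^sup>+y. ?p y \<partial>?P)"
  \<comment> \<open>The Lipschitz factor reads the output at \<open>t\<close> alone, the blocks only
    strictly earlier outputs.\<close>
  proof (rule nn_integral_Pi_pmf_mult[where A = "{t}" and B = "{t - int J * int (Suc L)..<t}"])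
    show "depends_on {t - int J * int (Suc L)..<t} ?p"
    proof (rule depends_on_prod)
      fix j assume "j \<in> {..<J}"
      then have "depends_on {t - int J * int (Suc L)..<t} (\<lambda>y. block_minor y t j)"
        using depends_on_mono[OF depends_on_block_minor block_subset] by simp
      then show "depends_on {t - int J * int (Suc L)..<t} (\<lambda>y. ennreal (1 - block_minor y t j))"
        using depends_on_compose2[where F = "\<lambda>u v. ennreal (1 - u)"] by blast
    qed
    show "depends_on {t} (\<lambda>y. ennreal (exp A) * ennreal (spread ^ y t))" by (rule depends_onI) simp
  qed (use W tW ltW in auto)
  finally have split: "(\<integral>\<^sup>+y. ennreal (exp A * spread ^ y t * (\<Prod>j<J. 1 - block_minor y t j)) \<partial>?P)
    = (\<integral>\<^sup>+y. ennreal (exp A) * ennreal (spread ^ y t) \<partial>?P) * (\<integral>\<^sup>+y. ?p y \<partial>?P)" .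
  have "(\<integral>\<^sup>+y. ?p y \<partial>?P) = (\<Prod>j<J. \<integral>\<^sup>+y. ennreal (1 - block_minor y t j) \<partial>?P)"
  proof (rule nn_integral_Pi_pmf_disjoint_prod[where S = "block t"])
    show "disjoint_family_on (block t) {..<J}"
      using disjoint_blocks by (rule disjoint_family_on_mono[OF subset_UNIV])
    show "depends_on (block t j) (\<lambda>y. ennreal (1 - block_minor y t j))" for j
      using depends_on_compose2[where F = "\<lambda>u v. ennreal (1 - u)"] depends_on_block_minor by blast
  qed (use W bW in auto)
  also have "\<dots> \<le> (\<Prod>j<J. if j < j0 then 1 else ennreal rate)"
  proof (rule prod_mono_ennreal)
    fix j assume j: "j \<in> {..<J}"
    show "(\<integral>\<^sup>+y. ennreal (1 - block_minor y t j) \<partial>?P) \<le> (if j < j0 then 1 else ennreal rate)"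
    proof (cases "j < j0")
      case True
      have "(\<integral>\<^sup>+y. ennreal (1 - block_minor y t j) \<partial>?P) \<le> (\<integral>\<^sup>+y. 1 \<partial>?P)"
        using block_minor_bounds(1)[of _ t j] by (intro nn_integral_mono) (simp add: less_imp_le)
      then show ?thesis using True by simp
    next
      case False
      then show ?thesis
        using nn_integral_block_minor[OF W(1) bW, of j \<zeta> d] z[of j] j by simp
    qed
  qed
  also have "(\<Prod>j<J. if j < j0 then 1 else ennreal rate) = (\<Prod>j\<in>{j0..<J}. ennreal rate)"
    by (rule prod.mono_neutral_cong_right) auto
  also have "\<dots> = ennreal (rate ^ (J - j0))" using rate_bounds by (simp add: ennreal_power)
  finally have decay: "(\<integral>\<^sup>+y. ?p y \<partial>?P) \<le> ennreal (rate ^ (J - j0))" .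
  have "(\<integral>\<^sup>+y. ennreal (exp A) * ennreal (spread ^ y t) \<partial>?P)
      = ennreal (exp A) * (\<integral>\<^sup>+n. ennreal (spread ^ n) \<partial>poisson_pmf (\<zeta> t))"
    using nn_integral_Pi_pmf_component[OF W(1) tW, where f = "\<lambda>n. ennreal (spread ^ n)"] by (simp add: nn_integral_cmult)
  also have "\<dots> = ennreal (exp A * exp (\<zeta> t * (spread - 1)))"
    using t s by (simp add: poisson_mgf ennreal_mult)
  also have "\<dots> \<le> ennreal (exp A * exp (D * (spread - 1)))"
    using t spread_ge_1 by (auto intro!: ennreal_leI mult_right_mono)
  finally have "(\<integral>\<^sup>+y. ennreal (exp A) * ennreal (spread ^ y t) \<partial>?P) \<le> ennreal (exp A * exp (D * (spread - 1)))" .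
  then show ?thesis unfolding split using decay rate_bounds by (simp add: mult_mono ennreal_mult)
qed

section \<open>The output entropy part\<close>

lemma component_measurable [measurable]: "(\<lambda>X. X i) \<in> borel_measurable inputs"
proof -
  have "sets F = sets (restrict_space borel {0..A})"
    using F_law by (simp add: space_prob_algebra)
  then have "(\<lambda>x. x) \<in> borel_measurable F"
    by (subst measurable_cong_sets[OF _ refl]) (auto intro: measurable_restrict_space1)
  then show ?thesis
    unfolding iid_inputs_def
    using measurable_compose[OF measurable_component_singleton[of i UNIV "\<lambda>_. F"]] by simp
qed

lemma Zx_bounds:
  assumes "X \<in> space inputs" "x \<ge> 0"
  shows "lam0 \<le> Zx x k X" "Zx x k X \<le> lam0 + (A + x)"
proof -
  have "0 \<le> (X(0 := x)) i" "(X(0 := x)) i \<le> A + x" for i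
    using assms A_nonneg by (auto simp: space_inputs intro: add_increasing2)
  then show "lam0 \<le> Zx x k X" "Zx x k X \<le> lam0 + (A + x)"
    by (auto intro!: Z_lower Z_upper)
qed

lemma Zx_lower:
  assumes "X \<in> space inputs" "x \<ge> 0" "t \<le> L"
  shows "h t * x \<le> Zx x (int t) X"
proof -
  have "h t * (X(0 := x)) (int t - int t) \<le> (\<Sum>l\<le>L. h l * (X(0 := x)) (int t - int l))"
    using assms h_nonneg by (intro member_le_sum[where f = "\<lambda>l. h l * (X(0 := x)) (int t - int l)"])
      (auto simp: space_inputs intro!: mult_nonneg_nonneg)
  then show ?thesis using lam0_pos unfolding Z_eq by simp
qed

lemma perturbed_mixture: "x \<ge> 0 \<Longrightarrow> poisson_mixture inputs (Zx x)"
proof unfold_locales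
  fix k show "Zx x k \<in> borel_measurable inputs"
  proof -
    have "(\<lambda>X. (X(0 := x)) i) \<in> borel_measurable inputs" for i
      by (cases "i = 0") auto
    then show ?thesis unfolding Z_eq by measurable
  qed
qed (use Zx_bounds(1) lam0_pos in \<open>auto intro: less_le_trans\<close>)

section \<open>The defined laws and truncations at real points\<close>

definition surprise :: "nat \<Rightarrow> nat \<Rightarrow> (int \<Rightarrow> nat) \<Rightarrow> real" where
  "surprise t m y = - ln (cond_weight y (int t - int m) (int t))"

lemma finite_window [simp]: "finite (window t m)"
  by (simp add: window_def)

lemma window_mono: "m \<le> m' \<Longrightarrow> window t m \<subseteq> window t m'"
  by (auto simp: window_def)

lemma t_in_window [simp]: "int t \<in> window t m"
  by (auto simp: window_def)

lemma depends_on_surprise: "depends_on (window t m) (surprise t m)"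
proof (rule depends_onI)
  fix y y' :: "int \<Rightarrow> nat" assume eq: "\<And>k. k \<in> window t m \<Longrightarrow> y k = y' k"
  have "path_weight y (int t - int m) s = path_weight y' (int t - int m) s" if "s \<le> int t + 1" for s
    using eq that by (auto simp: path_weight_def poisson_weight_def window_def fun_eq_iff intro!: prod.cong)
  then show "surprise t m y = surprise t m y'"
    by (simp add: surprise_def cond_weight_def)
qed

lemma channel_mean_of_real:
  "channel_mean L lam0 h (\<lambda>i. complex_of_real (X i)) k = of_real (channel_mean L lam0 h X k)"
  by (simp add: channel_mean_def)

lemma poisson_kernel_of_real: "poisson_kernel (of_real z) n = of_real (exp (- z) * z ^ n / fact n)"
  by (simp add: poisson_kernel_def exp_of_real flip: of_real_minus)

text \<open>At a real point every complex kernel is an ordinary Poisson probability, so the complex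
  measure becomes a genuine mixture.\<close>

lemma perturbed_law_of_real:
  assumes "x \<ge> 0"
  shows "perturbed_law L lam0 h F t m (of_real x) y =
    of_real (poisson_mixture.weight inputs (Zx x) (window t m) y)"
proof -
  have "(\<lambda>i. complex_of_real (X i))(0 := of_real x) = (\<lambda>i. of_real ((X(0 := x)) i))" for X :: "int \<Rightarrow> real"
    by auto
  then show ?thesis
    unfolding perturbed_law_def poisson_mixture.weight_def[OF perturbed_mixture[OF assms]]
    by (simp only: channel_mean_of_real poisson_kernel_of_real integral_complex_of_real flip: of_real_prod)
qed

lemma cylinder:
  assumes "finite J"
  shows "\<P>(Y in output_law L lam0 h F. \<forall>k\<in>J. Y k = y k) = base.weight J y"
  unfolding base.weight_def using output_law_cylinder(1)[OF lam0_pos _ F_law assms] h_nonneg by simp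

lemma baseline_law_eq: "baseline_law L lam0 h F t m y = base.weight (window t m) y"
  unfolding baseline_law_def by (rule cylinder) simp

text \<open>Both events in the conditional probability are cylinders; the numerator only extends the
  time interval by \<open>t\<close>.\<close>

lemma cond_output_prob_eq: "- ln (cond_output_prob L lam0 h F t m y) = surprise t m y"
proof -
  have w: "expectation (path_weight y i s) = base.weight {i..<s} y" for i s
    by (simp add: base.weight_def path_weight_def[abs_def] poisson_weight_def)
  have "{int t - int m..<int t + 1} = insert (int t) {int t - int m..<int t}" by auto
  then have "\<P>(Y in output_law L lam0 h F. Y (int t) = y (int t) \<and> (\<forall>k\<in>{int t - int m..<int t}. Y k = y k))
      = base.weight {int t - int m..<int t + 1} y"
    using cylinder[of "{int t - int m..<int t + 1}" y] by simp
  then show ?thesis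
    unfolding cond_output_prob_def cond_prob_def surprise_def cond_weight_def w
    by (simp add: cylinder)
qed

text \<open>The constant that \<open>quadratic_le_exp\<close> yields in
  \<open>abs_surprise_le\<close>; the summand 2 comes from bounding \<open>ln (fact n)\<close> by
  the square of \<open>n\<close>.\<close>

definition surprise_bound :: real where
  "surprise_bound = lam0 + A + \<bar>ln lam0\<bar> + \<bar>ln (lam0 + A)\<bar> + 2"

lemma ln_weight:
  "ln (weight_min n) = - (lam0 + A) + real n * ln lam0 - ln (fact n)"
  "ln (weight_max n) = - lam0 + real n * ln (lam0 + A) - ln (fact n)"
  using lam0_pos A_nonneg
  by (simp_all add: weight_min_def weight_max_def ln_div ln_mult ln_realpow)

lemma surprise_bounds:
  "- ln (weight_max (y (int t))) \<le> surprise t m y" "surprise t m y \<le> - ln (weight_min (y (int t)))"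
  using cond_weight_bounds[of "int t - int m" "int t" y] weight_min_pos[of "y (int t)"]
  unfolding surprise_def by (auto intro!: ln_mono)

text \<open>The bound involves only the output at \<open>t\<close> and is uniform in
  \<open>m\<close>, since \<open>surprise_bounds\<close> holds for every length of the observed
  past.\<close>

lemma abs_surprise_le: "\<bar>surprise t m y\<bar> \<le> surprise_bound * exp (real (y (int t)))"
proof -
  let ?n = "y (int t)"
  have 1: "real ?n * ln lam0 \<ge> - (\<bar>ln lam0\<bar> * real ?n)" "real ?n * ln (lam0 + A) \<le> \<bar>ln (lam0 + A)\<bar> * real ?n"
    using mult_left_mono[of "- \<bar>ln lam0\<bar>" "ln lam0" "real ?n"] mult_left_mono[of "ln (lam0 + A)" "\<bar>ln (lam0 + A)\<bar>" "real ?n"]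
    by (auto simp: mult.commute)
  have 2: "\<bar>ln lam0\<bar> * real ?n \<ge> 0" "\<bar>ln (lam0 + A)\<bar> * real ?n \<ge> 0" by auto
  have "ln (fact ?n :: real) \<ge> 0" by (simp add: fact_ge_1)
  then have "\<bar>surprise t m y\<bar> \<le> (lam0 + A) + (\<bar>ln lam0\<bar> * real ?n + \<bar>ln (lam0 + A)\<bar> * real ?n) + (real ?n)\<^sup>2"
    using surprise_bounds[where y = y and t = t and m = m] ln_fact_le_square[of ?n] 1 2 lam0_pos A_nonneg
    unfolding ln_weight abs_le_iff by linarith
  also have "\<dots> = (lam0 + A) + (\<bar>ln lam0\<bar> + \<bar>ln (lam0 + A)\<bar>) * real ?n + 1 * (real ?n)\<^sup>2"
    by (simp add: algebra_simps)
  also have "\<dots> \<le> (lam0 + A + (\<bar>ln lam0\<bar> + \<bar>ln (lam0 + A)\<bar>) + 2 * 1) * exp (real ?n)"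
    using lam0_pos A_nonneg by (intro quadratic_le_exp) auto
  finally show ?thesis by (simp add: surprise_bound_def algebra_simps)
qed

abbreviation mix_expectation :: "(int \<Rightarrow> (int \<Rightarrow> real) \<Rightarrow> real) \<Rightarrow> int set \<Rightarrow> ((int \<Rightarrow> nat) \<Rightarrow> real) \<Rightarrow> real" where
  "mix_expectation M W f \<equiv> measure_pmf.expectation (poisson_mixture.mix inputs M W) f"

definition Delta_real :: "nat \<Rightarrow> nat \<Rightarrow> real \<Rightarrow> real" where
  "Delta_real t m x =
    mix_expectation (Zx x) (window t m) (surprise t m) - mix_expectation Z (window t m) (surprise t m)"

lemma integrable_surprise:
  assumes "poisson_mixture inputs M" "finite W" "int t \<in> W" "\<And>X. X \<in> space inputs \<Longrightarrow> M (int t) X \<le> D"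
  shows "integrable (poisson_mixture.mix inputs M W) (surprise t m)"
  by (rule poisson_mixture.integrable_mix_exp_bound(1)[OF assms(1-3), where C = surprise_bound])
     (use assms(4) abs_surprise_le in auto)

text \<open>The surprise is integrable under both laws, so the two sums converge separately and may
  be subtracted.\<close>

lemma Delta_trunc_of_real:
  assumes "x \<ge> 0"
  shows "Delta_trunc L lam0 h F t m (of_real x) = of_real (Delta_real t m x)"
proof -
  let ?W = "window t m"
  have "((\<lambda>y. surprise t m y * poisson_mixture.weight inputs (Zx x) ?W y) has_sum
      mix_expectation (Zx x) ?W (surprise t m)) (?W \<rightarrow>\<^sub>E UNIV)"
    using Zx_bounds assms
    by (intro poisson_mixture.has_sum_mix perturbed_mixture integrable_surprise[where D = "lam0 + (A + x)"]) auto
  moreover have "((\<lambda>y. surprise t m y * base.weight ?W y) has_sum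
      mix_expectation Z ?W (surprise t m)) (?W \<rightarrow>\<^sub>E UNIV)"
    using Z_bounds
    by (intro base.has_sum_mix integrable_surprise[where D = "lam0 + A"] base.poisson_mixture_axioms) auto
  ultimately have "((\<lambda>y. surprise t m y * poisson_mixture.weight inputs (Zx x) ?W y
      - surprise t m y * base.weight ?W y) has_sum Delta_real t m x) (?W \<rightarrow>\<^sub>E UNIV)"
    unfolding Delta_real_def diff_conv_add_uminus by (intro has_sum_add has_sum_uminusI)
  then have "((\<lambda>y. complex_of_real (surprise t m y * poisson_mixture.weight inputs (Zx x) ?W y
      - surprise t m y * base.weight ?W y)) has_sum of_real (Delta_real t m x)) (?W \<rightarrow>\<^sub>E UNIV)"
    by (rule has_sum_of_real)
  then show ?thesis
    unfolding Delta_trunc_def cond_output_prob_eq perturbed_law_of_real[OF assms] baseline_law_eq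
    by (intro infsumI) (simp add: algebra_simps)
qed

section \<open>Comparison of different lengths of the observed past\<close>

definition forget_const :: "real \<Rightarrow> real" where
  "forget_const D = exp A * exp (D * (spread - 1))"

text \<open>Both pasts contain \<open>m div Suc L\<close> whole blocks, so
  \<open>ln_cond_weight_diff\<close> holds pointwise and \<open>nn_integral_forgetting\<close>
  averages it. \<open>D\<close> bounds the mean at time \<open>t\<close> alone; \<open>j0\<close>
  skips the blocks that the perturbation may reach.\<close>

lemma surprise_forgetting:
  assumes M: "poisson_mixture inputs M" and D: "\<And>X. X \<in> space inputs \<Longrightarrow> M (int t) X \<le> D"
    and z: "\<And>j k X. j0 \<le> j \<Longrightarrow> j < m div Suc L \<Longrightarrow> k \<in> block (int t) j \<Longrightarrow> X \<in> space inputs \<Longrightarrow> M k X \<le> lam0 + A"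
    and m: "m \<le> m'"
  shows "\<bar>mix_expectation M (window t m') (surprise t m) - mix_expectation M (window t m') (surprise t m')\<bar>
    \<le> forget_const D * rate ^ (m div Suc L - j0)"
proof -
  interpret M: poisson_mixture inputs M by (rule M)
  let ?W = "window t m'" and ?J = "m div Suc L"
  have "int ?J * int (Suc L) \<le> int m"
    unfolding of_nat_mult[symmetric] of_nat_le_iff by (rule div_times_less_eq_dividend)
  note J = this
  then have le: "int t - int m \<le> int t - int ?J * int (Suc L)" "int t - int m' \<le> int t - int ?J * int (Suc L)"
    using m by linarith+
  have int: "integrable (M.mix ?W) (surprise t k)" for k
    using D by (intro integrable_surprise M) auto
  have diff: "\<bar>surprise t m y - surprise t m' y\<bar>
      \<le> exp A * spread ^ y (int t) * (\<Prod>j<?J. 1 - block_minor y (int t) j)" for y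
    \<comment> \<open>The two pasts appear in exchanged order because \<open>surprise\<close> is
      minus the logarithm.\<close>
    using ln_cond_weight_diff[OF le(2,1), of y] by (simp add: surprise_def)
  have "\<bar>mix_expectation M ?W (surprise t m) - mix_expectation M ?W (surprise t m')\<bar>
    = \<bar>mix_expectation M ?W (\<lambda>y. surprise t m y - surprise t m' y)\<bar>"
    using int by simp
  also have "\<dots> \<le> mix_expectation M ?W (\<lambda>y. \<bar>surprise t m y - surprise t m' y\<bar>)"
    by (rule integral_abs_bound)
  finally have abs_diff: "\<bar>mix_expectation M ?W (surprise t m) - mix_expectation M ?W (surprise t m')\<bar>
    \<le> mix_expectation M ?W (\<lambda>y. \<bar>surprise t m y - surprise t m' y\<bar>)" .
  have "ennreal (mix_expectation M ?W (\<lambda>y. \<bar>surprise t m y - surprise t m' y\<bar>)) = (\<integral>\<^sup>+y. ennreal \<bar>surprise t m y - surprise t m' y\<bar> \<partial>M.mix ?W)"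
    using int by (intro nn_integral_eq_integral[symmetric]) auto
  also have "\<dots> \<le> (\<integral>\<^sup>+y. ennreal (exp A * spread ^ y (int t) * (\<Prod>j<?J. 1 - block_minor y (int t) j)) \<partial>M.mix ?W)"
    using diff by (intro nn_integral_mono ennreal_leI)
  also have "\<dots> \<le> ennreal (forget_const D * rate ^ (?J - j0))"
    unfolding forget_const_def
  proof (rule M.nn_integral_mix_le)
    fix X assume X: "X \<in> space inputs"
    show "(\<integral>\<^sup>+y. ennreal (exp A * spread ^ y (int t) * (\<Prod>j<?J. 1 - block_minor y (int t) j)) \<partial>M.kernel ?W X)
      \<le> ennreal (exp A * exp (D * (spread - 1)) * rate ^ (?J - j0))"
      using D[OF X] z[OF _ _ _ X] M.mean_pos[OF X] le
      by (intro nn_integral_forgetting) (auto simp: window_def)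
  qed simp
  finally have "mix_expectation M ?W (\<lambda>y. \<bar>surprise t m y - surprise t m' y\<bar>)
      \<le> forget_const D * rate ^ (?J - j0)"
    using rate_bounds by (simp add: forget_const_def ennreal_le_iff)
  with abs_diff show ?thesis by (rule order_trans)
qed

lemma mix_expectation_surprise:
  assumes "poisson_mixture inputs M" "m \<le> m'"
  shows "mix_expectation M (window t m) (surprise t m) = mix_expectation M (window t m') (surprise t m)"
  using poisson_mixture.expectation_mix_subset[OF assms(1) finite_window window_mono[OF assms(2)] depends_on_surprise] .

text \<open>Only blocks of index at least \<open>t\<close> are sure to escape the perturbation,
  hence the loss of \<open>t\<close> in the exponent. The constant depends on \<open>x\<close>,
  which is harmless for convergence in \<open>m\<close> at fixed \<open>x\<close>.\<close>

lemma Delta_real_diff: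
  assumes x: "x \<ge> 0" and m: "m \<le> m'"
  shows "\<bar>Delta_real t m x - Delta_real t m' x\<bar> \<le> 2 * forget_const (lam0 + (A + x)) * rate ^ (m div Suc L - t)"
proof -
  have "M k X \<le> lam0 + A" if "t \<le> j" "k \<in> block (int t) j" "X \<in> space inputs" "M = Z \<or> M = Zx x" for j k X M
  proof -
    \<comment> \<open>All times of block \<open>j\<close> are below \<open>t - j * (L + 1)\<close>,
      which is at most 0 when \<open>j\<close> is at least \<open>t\<close>.\<close>
    have "int t * 1 \<le> int j * int (Suc L)"
      using that(1) by (intro mult_mono) auto
    then have "k < 0" using that(2) by (auto simp: block_def)
    then show ?thesis using that(3,4) Z_bounds(2)[of X k] Zx_unaffected[of k X x] by auto
  qed
  note block = this
  have "\<bar>mix_expectation (Zx x) (window t m') (surprise t m) - mix_expectation (Zx x) (window t m') (surprise t m')\<bar>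
    \<le> forget_const (lam0 + (A + x)) * rate ^ (m div Suc L - t)"
    using x block Zx_bounds(2) by (intro surprise_forgetting perturbed_mixture m) auto
  moreover have "\<bar>mix_expectation Z (window t m') (surprise t m) - mix_expectation Z (window t m') (surprise t m')\<bar>
    \<le> forget_const (lam0 + (A + x)) * rate ^ (m div Suc L - t)"
    using x block by (intro surprise_forgetting base.poisson_mixture_axioms m)
      (auto intro: order_trans[OF Z_bounds(2)])
  ultimately show ?thesis
    unfolding Delta_real_def mix_expectation_surprise[OF perturbed_mixture[OF x] m]
      mix_expectation_surprise[OF base.poisson_mixture_axioms m]
    by linarith
qed

text \<open>For \<open>t > L\<close> the outputs at times \<open>L + 1, \<dots>, t\<close> have the same law under both input laws, so
  \<open>surprise t (t - L - 1)\<close> may be subtracted.\<close>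

lemma Delta_real_tail:
  assumes x: "x \<ge> 0" and t: "L < t" and m: "t \<le> m"
  shows "\<bar>Delta_real t m x\<bar> \<le> 2 * forget_const (lam0 + A) * rate ^ ((t - Suc L) div Suc L)"
proof -
  let ?s = "t - Suc L"
  have s: "?s \<le> m" "int t - int ?s = int L + 1" using t m by auto
  have unaffected: "Zx x k X \<le> lam0 + A" if "int L < k" "X \<in> space inputs" for k X
    using that Z_bounds(2)[of X k] Zx_unaffected[of k X x] by auto
  have "int L < k" if "j < ?s div Suc L" "k \<in> block (int t) j" for j k
  proof -
    have "int (?s div Suc L) * int (Suc L) \<le> int ?s"
      unfolding of_nat_mult[symmetric] of_nat_le_iff by (rule div_times_less_eq_dividend)
    then show ?thesis using block_subset[OF that(1), of "int t"] that(2) s by auto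
  qed
  note block = this
  \<comment> \<open>The blocks start after time \<open>L\<close> and \<open>t\<close> itself exceeds
    \<open>L\<close>, so no mean that enters depends on \<open>x\<close>. Thus \<open>j0 = 0\<close>
    and \<open>D = lam0 + A\<close> are allowed, and the bound is uniform in
    \<open>x\<close>.\<close>
  have "\<bar>mix_expectation (Zx x) (window t m) (surprise t ?s) - mix_expectation (Zx x) (window t m) (surprise t m)\<bar>
    \<le> forget_const (lam0 + A) * rate ^ (?s div Suc L - 0)"
    using x t unaffected block by (intro surprise_forgetting perturbed_mixture s) auto
  moreover have "\<bar>mix_expectation Z (window t m) (surprise t ?s) - mix_expectation Z (window t m) (surprise t m)\<bar>
    \<le> forget_const (lam0 + A) * rate ^ (?s div Suc L - 0)"
    using Z_bounds(2) by (intro surprise_forgetting base.poisson_mixture_axioms s) auto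
  moreover have "mix_expectation (Zx x) (window t m) (surprise t ?s) = mix_expectation Z (window t m) (surprise t ?s)"
  proof -
    have "poisson_mixture.mix inputs (Zx x) (window t ?s) = poisson_mixture.mix inputs Z (window t ?s)"
      using t by (intro mix_cong perturbed_mixture x base.poisson_mixture_axioms finite_window Zx_unaffected)
        (auto simp: window_def)
    then show ?thesis
      unfolding mix_expectation_surprise[OF perturbed_mixture[OF x] s(1), symmetric]
        mix_expectation_surprise[OF base.poisson_mixture_axioms s(1), symmetric] by simp
  qed
  ultimately show ?thesis unfolding Delta_real_def diff_zero by linarith
qed

section \<open>The limit in \<open>m\<close> and the sum over \<open>t\<close>\<close>

lemma rate_block_tendsto: "(\<lambda>m. c * rate ^ (m div Suc L - t)) \<longlonglongrightarrow> 0"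
proof -
  have "filterlim (\<lambda>m. m div Suc L - t) at_top sequentially"
    unfolding filterlim_at_top
  proof
    fix N
    show "eventually (\<lambda>m. N \<le> m div Suc L - t) sequentially"
    proof (rule eventually_sequentiallyI)
      fix m assume "(N + t) * Suc L \<le> m"
      then have "N + t \<le> m div Suc L" by (simp add: less_eq_div_iff_mult_less_eq)
      then show "N \<le> m div Suc L - t" by simp
    qed
  qed
  then have "(\<lambda>m. rate ^ (m div Suc L - t)) \<longlonglongrightarrow> 0"
    using rate_bounds by (intro filterlim_compose[OF LIMSEQ_power_zero]) auto
  then show ?thesis by (rule tendsto_mult_right_zero)
qed

lemma Delta_real_convergent:
  assumes "x \<ge> 0"
  shows "convergent (\<lambda>m. Delta_real t m x)"
  unfolding Cauchy_convergent_iff[symmetric]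
proof (rule CauchyI')
  fix e :: real assume "e > 0"
  have "eventually (\<lambda>m. 2 * forget_const (lam0 + (A + x)) * rate ^ (m div Suc L - t) < e) sequentially"
    using order_tendstoD(2)[OF rate_block_tendsto \<open>e > 0\<close>] .
  then obtain N where N: "\<And>m. m \<ge> N \<Longrightarrow> 2 * forget_const (lam0 + (A + x)) * rate ^ (m div Suc L - t) < e"
    by (auto simp: eventually_sequentially)
  have "dist (Delta_real t m x) (Delta_real t n x) < e" if "N \<le> m" "m < n" for m n
    using Delta_real_diff[OF assms, of m n t] N[OF that(1)] that(2) by (simp add: dist_real_def)
  then show "\<exists>M. \<forall>m\<ge>M. \<forall>n>m. dist (Delta_real t m x) (Delta_real t n x) < e" by blast
qed

definition Delta_lim :: "real \<Rightarrow> nat \<Rightarrow> real" where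
  "Delta_lim x t = lim (\<lambda>m. Delta_real t m x)"

lemma Delta_lim: "x \<ge> 0 \<Longrightarrow> (\<lambda>m. Delta_real t m x) \<longlonglongrightarrow> Delta_lim x t"
  unfolding Delta_lim_def using Delta_real_convergent by (simp add: convergent_LIMSEQ_iff)

lemma Delta_of_real: "x \<ge> 0 \<Longrightarrow> Delta L lam0 h F t (of_real x) = of_real (Delta_lim x t)"
  unfolding Delta_def Delta_trunc_of_real by (intro limI tendsto_of_real Delta_lim)

lemma Delta_lim_tail:
  assumes "x \<ge> 0"
  shows "\<bar>Delta_lim x (n + Suc L)\<bar> \<le> 2 * forget_const (lam0 + A) * rate ^ (n div Suc L)"
proof (rule tendsto_upperbound[OF tendsto_rabs[OF Delta_lim[OF assms]]])
  show "\<forall>\<^sub>F m in sequentially. \<bar>Delta_real (n + Suc L) m x\<bar> \<le> 2 * forget_const (lam0 + A) * rate ^ (n div Suc L)"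
    using Delta_real_tail[OF assms, of "n + Suc L"] by (intro eventually_sequentiallyI[of "n + Suc L"]) simp
qed simp

text \<open>Each exponent occurs \<open>L + 1\<close> times; grouping equal terms leaves a geometric
  series.\<close>

lemma summable_rate_block: "summable (\<lambda>n. rate ^ (n div Suc L))"
proof (rule summableI_nonneg_bounded)
  fix n
  have "(\<Sum>i<n. rate ^ (i div Suc L)) \<le> (\<Sum>i<n * Suc L. rate ^ (i div Suc L))"
    using rate_bounds by (intro sum_mono2) auto
  also have "\<dots> = (\<Sum>j<n. \<Sum>i=j * Suc L..<j * Suc L + Suc L. rate ^ (i div Suc L))"
    by (rule sum.nat_group[symmetric])
  also have "\<dots> = (\<Sum>j<n. \<Sum>i=j * Suc L..<j * Suc L + Suc L. rate ^ j)"
  proof (intro sum.cong refl)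
    fix j i assume "i \<in> {j * Suc L..<j * Suc L + Suc L}"
    then have "i div Suc L = j" by (intro div_nat_eqI) (auto simp: algebra_simps)
    then show "rate ^ (i div Suc L) = rate ^ j" by simp
  qed
  also have "\<dots> = real (Suc L) * (\<Sum>j<n. rate ^ j)"
    by (simp add: sum_distrib_left del: of_nat_Suc)
  also have "\<dots> \<le> real (Suc L) * (\<Sum>j. rate ^ j)"
    using rate_bounds by (intro mult_left_mono sum_le_suminf summable_geometric) auto
  finally show "(\<Sum>i<n. rate ^ (i div Suc L)) \<le> real (Suc L) * (\<Sum>j. rate ^ j)" .
qed (use rate_bounds in auto)

definition tail_const :: real where
  "tail_const = (\<Sum>n. 2 * forget_const (lam0 + A) * rate ^ (n div Suc L))"

text \<open>The terms with \<open>t > L\<close> are dominated by a convergent series free of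
  \<open>x\<close>, so dropping them costs a constant.\<close>

lemma Delta_lim_sum:
  assumes x: "x \<ge> 0"
  shows "summable (Delta_lim x)" "(\<Sum>t\<le>L. Delta_lim x t) - tail_const \<le> (\<Sum>t. Delta_lim x t)"
proof -
  let ?g = "\<lambda>n. 2 * forget_const (lam0 + A) * rate ^ (n div Suc L)"
  have g: "summable ?g" using summable_rate_block by (rule summable_mult)
  have s: "summable (\<lambda>n. Delta_lim x (n + Suc L))"
    using Delta_lim_tail[OF x] by (intro summable_comparison_test'[OF g]) simp
  then show sum: "summable (Delta_lim x)" by (subst (asm) summable_iff_shift)
  have "- tail_const = (\<Sum>n. - ?g n)" unfolding tail_const_def using g by (rule suminf_minus[symmetric])
  also have "\<dots> \<le> (\<Sum>n. Delta_lim x (n + Suc L))"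
  proof (intro suminf_le s summable_minus g)
    show "- ?g n \<le> Delta_lim x (n + Suc L)" for n
      using Delta_lim_tail[OF x, of n] by linarith
  qed
  finally show "(\<Sum>t\<le>L. Delta_lim x t) - tail_const \<le> (\<Sum>t. Delta_lim x t)"
    using suminf_split_initial_segment[OF sum, of "Suc L"] by (simp add: lessThan_Suc_atMost)
qed

lemma hdot_Y_of_real: "x \<ge> 0 \<Longrightarrow> hdot_Y L lam0 h F (of_real x) = of_real (\<Sum>t. Delta_lim x t)"
  unfolding hdot_Y_def Delta_of_real by (rule suminf_of_real[symmetric]) (rule Delta_lim_sum)

section \<open>Growth of the terms at the affected times\<close>

lemma mean_output:
  assumes x: "x \<ge> 0" and t: "t \<le> L"
  shows "integrable (poisson_mixture.mix inputs (Zx x) (window t m)) (\<lambda>y. real (y (int t)))"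
    "h t * x \<le> mix_expectation (Zx x) (window t m) (\<lambda>y. real (y (int t)))"
proof -
  interpret M: poisson_mixture inputs "Zx x" using x by (rule perturbed_mixture)
  show int: "integrable (M.mix (window t m)) (\<lambda>y. real (y (int t)))"
    using Zx_bounds(2)[OF _ x] quadratic_le_exp[of 0 1 0]
    by (intro M.integrable_mix_exp_bound(1)[where k = "int t" and C = 1]) auto
  have "ennreal (h t * x) \<le> (\<integral>\<^sup>+y. ennreal (real (y (int t))) \<partial>M.mix (window t m))"
  proof (rule M.nn_integral_mix_ge)
    fix X assume X: "X \<in> space inputs"
    have "(\<integral>\<^sup>+y. ennreal (real (y (int t))) \<partial>M.kernel (window t m) X)
      = (\<integral>\<^sup>+n. ennreal (real n) \<partial>poisson_pmf (Zx x (int t) X))"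
      by (rule nn_integral_Pi_pmf_component) auto
    also have "\<dots> = ennreal (Zx x (int t) X)"
      by (rule nn_integral_poisson[OF M.mean_pos[OF X] _ poisson_mean_sums]) simp
    finally show "ennreal (h t * x) \<le> (\<integral>\<^sup>+y. ennreal (real (y (int t))) \<partial>M.kernel (window t m) X)"
      using Zx_lower[OF X x t] by (simp add: ennreal_leI)
  qed simp
  also have "\<dots> = ennreal (mix_expectation (Zx x) (window t m) (\<lambda>y. real (y (int t))))"
    using int by (intro nn_integral_eq_integral) auto
  finally show "h t * x \<le> mix_expectation (Zx x) (window t m) (\<lambda>y. real (y (int t)))"
    by (subst (asm) ennreal_le_iff) auto
qed

lemma h_le_1: "t \<le> L \<Longrightarrow> h t \<le> 1"
  using member_le_sum[of t "{..L}" h] h_nonneg h_sum by auto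

text \<open>With \<open>n\<close> the output at \<open>t\<close>, the surprise is at least
  \<open>- ln (weight_max n)\<close>, and \<open>ln_fact_ge\<close> with \<open>s = x\<close> makes
  this at least \<open>n * (ln x - ln (lam0 + A)) - x\<close>. The perturbed mean of
  \<open>n\<close> is at least \<open>h t * x\<close>.\<close>

lemma Delta_real_lower:
  assumes x: "1 \<le> x" "lam0 + A \<le> x" and t: "t \<le> L"
  shows "h t * (x * ln x) - (1 + \<bar>ln (lam0 + A)\<bar>) * x - surprise_bound * exp ((lam0 + A) * (exp 1 - 1))
    \<le> Delta_real t m x"
proof -
  let ?W = "window t m" and ?b = "lam0 + A"
  have x0: "x \<ge> 0" and b: "?b > 0" using x lam0_pos A_nonneg by auto
  note M = perturbed_mixture[OF x0]
  have "h t * x * ln x - \<bar>ln ?b\<bar> * x \<le> h t * x * (ln x - ln ?b)"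
  proof -
    have "h t * x * ln ?b \<le> h t * x * \<bar>ln ?b\<bar>"
      using h_nonneg[OF t] x0 by (intro mult_left_mono) auto
    also have "\<dots> \<le> 1 * x * \<bar>ln ?b\<bar>"
      using h_le_1[OF t] x0 by (intro mult_right_mono) auto
    finally have "h t * x * ln ?b \<le> 1 * x * \<bar>ln ?b\<bar>" .
    then show ?thesis by (simp add: algebra_simps)
  qed
  \<comment> \<open>The hypothesis \<open>lam0 + A \<le> x\<close> makes the factor
    \<open>ln x - ln ?b\<close> nonnegative, as multiplying the bound on the mean requires.\<close>
  also have "\<dots> \<le> mix_expectation (Zx x) ?W (\<lambda>y. real (y (int t))) * (ln x - ln ?b)"
    using x b by (intro mult_right_mono mean_output x0 t) simp
  also have "\<dots> - x = mix_expectation (Zx x) ?W (\<lambda>y. real (y (int t)) * (ln x - ln ?b) - x)"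
    using mean_output(1)[OF x0 t] by simp
  also have "\<dots> \<le> mix_expectation (Zx x) ?W (surprise t m)"
  proof (rule integral_mono)
    show "integrable (poisson_mixture.mix inputs (Zx x) ?W) (surprise t m)"
      using Zx_bounds(2)[OF _ x0] by (intro integrable_surprise[OF M]) auto
    fix y :: "int \<Rightarrow> nat"
    show "real (y (int t)) * (ln x - ln ?b) - x \<le> surprise t m y"
      using surprise_bounds(1)[where y = y and t = t and m = m] ln_fact_ge[of x "y (int t)"] x lam0_pos
      by (simp add: ln_weight algebra_simps)
  qed (use mean_output(1)[OF x0 t] in simp)
  finally have "h t * (x * ln x) - (1 + \<bar>ln ?b\<bar>) * x \<le> mix_expectation (Zx x) ?W (surprise t m)"
    by (simp add: algebra_simps)
  \<comment> \<open>The baseline expectation does not involve \<open>x\<close>, so a constant bounds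
    it.\<close>
  moreover have "mix_expectation Z ?W (surprise t m) \<le> surprise_bound * exp (?b * (exp 1 - 1))"
    using base.integrable_mix_exp_bound(2)[of ?W "int t" ?b "surprise t m" surprise_bound]
      Z_bounds(2) abs_surprise_le by fastforce
  ultimately show ?thesis unfolding Delta_real_def by linarith
qed

lemma Delta_lim_lower:
  assumes x: "1 \<le> x" "lam0 + A \<le> x" and t: "t \<le> L"
  shows "h t * (x * ln x) - (1 + \<bar>ln (lam0 + A)\<bar>) * x - surprise_bound * exp ((lam0 + A) * (exp 1 - 1))
    \<le> Delta_lim x t"
  using x by (intro tendsto_lowerbound[OF Delta_lim] always_eventually allI Delta_real_lower[OF x t]) auto

end

section \<open>The conditional entropy part\<close>

definition real_poisson_entropy :: "real \<Rightarrow> real" where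
  "real_poisson_entropy \<zeta> = \<zeta> - \<zeta> * ln \<zeta> + (\<Sum>m. \<zeta> ^ m / fact m * exp (- \<zeta>) * ln (fact m))"

lemma summable_poisson_ln_fact:
  fixes \<zeta> :: real
  assumes "\<zeta> \<ge> 0"
  shows "summable (\<lambda>m. \<zeta> ^ m / fact m * exp (- \<zeta>) * ln (fact m))"
proof (rule summable_comparison_test')
  show "summable (\<lambda>m. \<zeta> ^ m / fact m * exp (- \<zeta>) * (real m)\<^sup>2)"
    using poisson_second_moment_sums by (rule sums_summable)
  show "norm (\<zeta> ^ m / fact m * exp (- \<zeta>) * ln (fact m)) \<le> \<zeta> ^ m / fact m * exp (- \<zeta>) * (real m)\<^sup>2" for m
    using assms ln_fact_le_square[of m] by (simp add: abs_mult fact_ge_1 divide_right_mono mult_left_mono mult_right_mono)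
qed

lemma poisson_entropy_of_real:
  assumes "\<zeta> > 0"
  shows "poisson_entropy (of_real \<zeta>) = of_real (real_poisson_entropy \<zeta>)"
proof -
  have "poisson_kernel (of_real \<zeta>) m * of_real (ln (fact m)) =
    of_real (\<zeta> ^ m / fact m * exp (- \<zeta>) * ln (fact m))" for m
    by (simp add: poisson_kernel_def exp_of_real flip: of_real_minus)
  then have "(\<Sum>m. poisson_kernel (of_real \<zeta>) m * of_real (ln (fact m))) =
    of_real (\<Sum>m. \<zeta> ^ m / fact m * exp (- \<zeta>) * ln (fact m))"
    using suminf_of_real[OF summable_poisson_ln_fact[of \<zeta>], where 'a = complex] assms by simp
  then show ?thesis
    using assms by (simp add: poisson_entropy_def real_poisson_entropy_def Ln_of_real)
qed

text \<open>Bound \<open>ln (fact m)\<close> by \<open>m * ln m\<close> and the logarithm by its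
  tangent at \<zeta>. The first two Poisson moments then give
  \<open>\<zeta> * ln \<zeta> + 1\<close> for the series, and \<open>\<zeta> * ln \<zeta>\<close>
  cancels.\<close>

lemma real_poisson_entropy_le:
  assumes "\<zeta> > 0"
  shows "real_poisson_entropy \<zeta> \<le> \<zeta> + 1"
proof -
  let ?w = "\<lambda>m. \<zeta> ^ m / fact m * exp (- \<zeta>)"
  have le: "ln (fact m) \<le> real m * (ln \<zeta> - 1) + (real m)\<^sup>2 * (1 / \<zeta>)" for m
  proof (cases "m = 0")
    case False
    have "ln (fact m :: real) \<le> ln (real m ^ m)"
      using fact_le_power[of m, where 'a = real] False by (intro ln_mono) auto
    also have "\<dots> = real m * (ln \<zeta> + ln (real m / \<zeta>))"
      using False assms by (simp add: ln_realpow ln_div)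
    also have "\<dots> \<le> real m * (ln \<zeta> + (real m / \<zeta> - 1))"
      using False assms by (intro mult_left_mono add_left_mono ln_le_minus_one) auto
    finally show ?thesis by (simp add: algebra_simps power2_eq_square)
  qed simp
  have sums: "(\<lambda>m. ?w m * real m * (ln \<zeta> - 1) + ?w m * (real m)\<^sup>2 * (1 / \<zeta>)) sums
      (\<zeta> * (ln \<zeta> - 1) + (\<zeta>\<^sup>2 + \<zeta>) * (1 / \<zeta>))"
    by (intro sums_add sums_mult2 poisson_mean_sums poisson_second_moment_sums)
  have "(\<Sum>m. ?w m * ln (fact m)) \<le> (\<Sum>m. ?w m * real m * (ln \<zeta> - 1) + ?w m * (real m)\<^sup>2 * (1 / \<zeta>))"
  proof (intro suminf_le summable_poisson_ln_fact sums_summable[OF sums])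
    fix m
    have "?w m * ln (fact m) \<le> ?w m * (real m * (ln \<zeta> - 1) + (real m)\<^sup>2 * (1 / \<zeta>))"
      using assms by (intro mult_left_mono le) simp
    then show "?w m * ln (fact m) \<le> ?w m * real m * (ln \<zeta> - 1) + ?w m * (real m)\<^sup>2 * (1 / \<zeta>)"
      by (simp only: distrib_left mult.assoc)
  qed (use assms in simp)
  also have "\<dots> = \<zeta> * ln \<zeta> + 1"
    unfolding sums_unique[OF sums, symmetric] using assms by (simp add: field_simps power2_eq_square)
  finally show ?thesis unfolding real_poisson_entropy_def by simp
qed

text \<open>A crude bound suffices: it is applied only to the baseline mean, which is at most
  \<open>lam0 + A\<close>.\<close>

lemma real_poisson_entropy_ge:
  assumes "\<zeta> > 0"
  shows "- \<zeta>\<^sup>2 \<le> real_poisson_entropy \<zeta>"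
proof -
  have "\<zeta> * ln \<zeta> \<le> \<zeta> * \<zeta>" using assms ln_bound[of \<zeta>] by (intro mult_left_mono) auto
  moreover have "0 \<le> (\<Sum>m. \<zeta> ^ m / fact m * exp (- \<zeta>) * ln (fact m))"
    using assms by (intro suminf_nonneg summable_poisson_ln_fact) (auto simp: fact_ge_1)
  ultimately show ?thesis using assms unfolding real_poisson_entropy_def power2_eq_square by linarith
qed

context isi_channel
begin

text \<open>The \<open>r\<close>-th summand is the entropy change at time 0 when the input at time
  \<open>-r\<close> is set to \<open>x\<close>. An upper bound is what matters, because this part is
  subtracted in \<open>Psi\<close>.\<close>

lemma hdot_YX_of_real:
  assumes x: "x \<ge> 0"
  shows "\<exists>H. hdot_YX L lam0 h F (of_real x) = of_real H \<and>
    H \<le> real (Suc L) * (1 + (lam0 + (A + x)) + (lam0 + A)\<^sup>2)"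
proof -
  let ?\<zeta> = "\<lambda>r X. channel_mean L lam0 h (X(- int r := x)) 0"
  let ?f = "\<lambda>r X. real_poisson_entropy (?\<zeta> r X) - real_poisson_entropy (Z 0 X)"
  let ?C = "1 + (lam0 + (A + x)) + (lam0 + A)\<^sup>2"
  have bounds: "lam0 \<le> ?\<zeta> r X" "?\<zeta> r X \<le> lam0 + (A + x)" if "X \<in> space inputs" for r X
  proof -
    have "0 \<le> (X(- int r := x)) i" "(X(- int r := x)) i \<le> A + x" for i
      using that x A_nonneg by (auto simp: space_inputs intro: add_increasing2)
    then show "lam0 \<le> ?\<zeta> r X" "?\<zeta> r X \<le> lam0 + (A + x)"
      by (auto intro!: Z_lower Z_upper)
  qed
  have eq1: "of_real lam0 + of_real (h r) * of_real x + (\<Sum>l\<in>{..L} - {r}. complex_of_real (h l * X (- int l)))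
      = of_real (?\<zeta> r X)" if "r \<le> L" for r and X :: "int \<Rightarrow> real"
  proof -
    have "(\<Sum>l\<le>L. h l * (X(- int r := x)) (0 - int l)) = h r * x + (\<Sum>l\<in>{..L} - {r}. h l * X (- int l))"
      using that by (subst sum.remove[of _ r]) (auto intro!: sum.cong)
    then show ?thesis unfolding Z_eq by simp
  qed
  have eq2: "of_real (lam0 + (\<Sum>l\<le>L. h l * X (- int l))) = complex_of_real (Z 0 X)" for X :: "int \<Rightarrow> real"
    unfolding Z_eq by simp
  have "hdot_YX L lam0 h F (of_real x) = (\<Sum>r\<le>L. \<integral>X. complex_of_real (?f r X) \<partial>inputs)"
    unfolding hdot_YX_def eq2
  proof (intro sum.cong refl Bochner_Integration.integral_cong, unfold atMost_iff)
    fix r X assume r: "r \<le> L" and X: "X \<in> space inputs"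
    show "poisson_entropy (of_real lam0 + of_real (h r) * of_real x
          + (\<Sum>l\<in>{..L} - {r}. complex_of_real (h l * X (- int l)))) - poisson_entropy (of_real (Z 0 X))
      = of_real (?f r X)"
      unfolding eq1[OF r] using bounds[OF X, of r] Z_bounds[OF X, of 0] lam0_pos
      by (simp add: poisson_entropy_of_real)
  qed
  also have "\<dots> = of_real (\<Sum>r\<le>L. \<integral>X. ?f r X \<partial>inputs)"
    by (simp only: integral_complex_of_real of_real_sum)
  finally have "hdot_YX L lam0 h F (of_real x) = of_real (\<Sum>r\<le>L. \<integral>X. ?f r X \<partial>inputs)" .
  moreover have "(\<Sum>r\<le>L. \<integral>X. ?f r X \<partial>inputs) \<le> (\<Sum>r\<le>L. ?C)"
  proof (rule sum_mono)
    fix r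
    have "(\<integral>X. ?f r X \<partial>inputs) \<le> (\<integral>X. ?C \<partial>inputs)"
    \<comment> \<open>This rule asks for integrability of the nonnegative upper bound alone, here a
      constant, so measurability of the entropy terms need not be established.\<close>
    proof (rule integral_mono')
      fix X assume X: "X \<in> space inputs"
      have "(Z 0 X)\<^sup>2 \<le> (lam0 + A)\<^sup>2"
        using Z_bounds[OF X, of 0] lam0_pos by (intro power_mono) auto
      then show "?f r X \<le> ?C"
        using real_poisson_entropy_le[of "?\<zeta> r X"] real_poisson_entropy_ge[of "Z 0 X"]
          bounds[OF X, of r] Z_bounds[OF X, of 0] lam0_pos by linarith
    qed (use x lam0_pos A_nonneg in auto)
    then show "(\<integral>X. ?f r X \<partial>inputs) \<le> ?C" by (simp add: prob_space)
  qed
  ultimately show ?thesis by (intro exI[of _ "\<Sum>r\<le>L. \<integral>X. ?f r X \<partial>inputs"] conjI) simp_all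
qed

text \<open>Summing the lower bounds over \<open>t \<le> L\<close> gives exactly
  \<open>x * ln x\<close> as leading term because the \<open>h t\<close> add up to 1; everything
  else is at most linear in \<open>x\<close>.\<close>

lemma Psi_lower_bound:
  "\<exists>C\<ge>0. \<forall>x. 1 \<le> x \<longrightarrow> lam0 + A \<le> x \<longrightarrow>
    Psi L lam0 h F (of_real x) \<in> \<real> \<and> x * ln x - C * x \<le> Re (Psi L lam0 h F (of_real x))"
proof -
  define c where "c = surprise_bound * exp ((lam0 + A) * (exp 1 - 1))"
  \<comment> \<open>\<open>d\<close> collects the terms constant in \<open>x\<close>, which are at
    most \<open>d * x\<close> as \<open>1 \<le> x\<close>. \<open>C\<close> adds the linear
    coefficients per time: \<open>1 + \<bar>ln (lam0 + A)\<bar>\<close> from the output part and 1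
    from the conditional entropy.\<close>
  define d where "d = \<bar>tail_const\<bar> + real (Suc L) * (\<bar>c\<bar> + (1 + (lam0 + A) + (lam0 + A)\<^sup>2))"
  define C where "C = d + real (Suc L) * (2 + \<bar>ln (lam0 + A)\<bar>)"
  have d: "d \<ge> 0" unfolding d_def using lam0_pos A_nonneg by (intro add_nonneg_nonneg mult_nonneg_nonneg) auto
  have "Psi L lam0 h F (of_real x) \<in> \<real> \<and> x * ln x - C * x \<le> Re (Psi L lam0 h F (of_real x))"
    if x: "1 \<le> x" "lam0 + A \<le> x" for x
  proof -
    have x0: "x \<ge> 0" using x by simp
    obtain H where H: "hdot_YX L lam0 h F (of_real x) = of_real H"
      "H \<le> real (Suc L) * (1 + (lam0 + (A + x)) + (lam0 + A)\<^sup>2)"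
      using hdot_YX_of_real[OF x0] by blast
    have Psi: "Psi L lam0 h F (of_real x) = of_real ((\<Sum>t. Delta_lim x t) - H)"
      unfolding Psi_def hdot_Y_of_real[OF x0] H(1) by simp
    have "(\<Sum>t\<le>L. h t * (x * ln x) - (1 + \<bar>ln (lam0 + A)\<bar>) * x - c) \<le> (\<Sum>t\<le>L. Delta_lim x t)"
      unfolding c_def by (intro sum_mono Delta_lim_lower x) simp
    also have "(\<Sum>t\<le>L. h t * (x * ln x) - (1 + \<bar>ln (lam0 + A)\<bar>) * x - c)
      = x * ln x - real (Suc L) * ((1 + \<bar>ln (lam0 + A)\<bar>) * x + c)"
      using h_sum by (simp add: sum_subtractf algebra_simps flip: sum_distrib_left)
    finally have "x * ln x - real (Suc L) * ((1 + \<bar>ln (lam0 + A)\<bar>) * x + c) - tail_const \<le> (\<Sum>t. Delta_lim x t)"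
      using Delta_lim_sum(2)[OF x0] by linarith
    moreover have "real (Suc L) * c \<le> real (Suc L) * \<bar>c\<bar>" by (intro mult_left_mono) auto
    moreover have "d * 1 \<le> d * x" using d x by (intro mult_left_mono) auto
    then have "\<bar>tail_const\<bar> + real (Suc L) * \<bar>c\<bar> + real (Suc L) * (1 + (lam0 + A) + (lam0 + A)\<^sup>2) \<le> d * x"
      by (simp add: d_def distrib_left)
    moreover have "H \<le> real (Suc L) * (1 + (lam0 + A) + (lam0 + A)\<^sup>2) + real (Suc L) * x"
      using H(2) by (simp add: algebra_simps)
    moreover have "C * x = d * x + real (Suc L) * ((1 + \<bar>ln (lam0 + A)\<bar>) * x) + real (Suc L) * x"
      by (simp add: C_def algebra_simps)
    moreover have "real (Suc L) * ((1 + \<bar>ln (lam0 + A)\<bar>) * x + c)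
        = real (Suc L) * ((1 + \<bar>ln (lam0 + A)\<bar>) * x) + real (Suc L) * c"
      by (rule distrib_left)
    ultimately have "x * ln x - C * x \<le> (\<Sum>t. Delta_lim x t) - H"
      using abs_ge_self[of tail_const] by linarith
    then show ?thesis unfolding Psi by simp
  qed
  moreover have "C \<ge> 0" unfolding C_def using d by (intro add_nonneg_nonneg mult_nonneg_nonneg) auto
  ultimately show ?thesis by blast
qed

end

theorem lemma7:
  fixes L :: nat and lam0 A P_avg :: real and h :: "nat \<Rightarrow> real" and F :: "real measure"
  assumes "lam0 > 0"
    and "h 0 > 0" and "\<And>l. l \<le> L \<Longrightarrow> h l \<ge> 0" and "(\<Sum>l\<le>L. h l) = 1"
    and "A \<ge> 0" and "P_avg \<ge> 0"
    and "F \<in> input_laws A P_avg"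
  shows "(\<exists>R \<in> O[at_top](\<lambda>x::real. x). \<forall>\<^sub>F x in at_top.
            Psi L lam0 h F (of_real x) \<in> \<real> \<and> Re (Psi L lam0 h F (of_real x)) \<ge> x * ln x - R x)
       \<and> (\<forall>lam::real. lam \<ge> 0 \<longrightarrow>
            filterlim (\<lambda>x::real. Re (Psi L lam0 h F (of_real x)) - lam * x) at_top at_top)"
proof -
  interpret isi_channel L lam0 A h F
    using assms by unfold_locales (auto simp: input_laws_def)
  obtain C where C: "\<And>x. 1 \<le> x \<Longrightarrow> lam0 + A \<le> x \<Longrightarrow>
      Psi L lam0 h F (of_real x) \<in> \<real> \<and> x * ln x - C * x \<le> Re (Psi L lam0 h F (of_real x))"
    using Psi_lower_bound by blast
  have ev: "\<forall>\<^sub>F x in at_top. Psi L lam0 h F (of_real x) \<in> \<real> \<and>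
      Re (Psi L lam0 h F (of_real x)) \<ge> x * ln x - C * x"
    using eventually_ge_at_top[of 1] eventually_ge_at_top[of "lam0 + A"] by eventually_elim (rule C)
  have "filterlim (\<lambda>x::real. Re (Psi L lam0 h F (of_real x)) - lam * x) at_top at_top" for lam
  proof (rule filterlim_at_top_mono)
    show "filterlim (\<lambda>x::real. x * (- (C + lam) + ln x)) at_top at_top"
      by (intro filterlim_at_top_mult_at_top filterlim_ident filterlim_tendsto_add_at_top[OF tendsto_const] ln_at_top)
    show "\<forall>\<^sub>F x in at_top. x * (- (C + lam) + ln x) \<le> Re (Psi L lam0 h F (of_real x)) - lam * x"
      using ev by eventually_elim (simp add: algebra_simps)
  qed
  \<comment> \<open>The witness for \<open>R\<close> is the linear function with slope
    \<open>C\<close>.\<close>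
  moreover have "(\<lambda>x. C * x) \<in> O[at_top](\<lambda>x::real. x)" by simp
  ultimately show ?thesis using ev by blast
qed

end
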